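(* The non-unital $C^*$-algebra $\mathfrak{I}\subset\mathfrak{B}$ generated by $\{b_i : i\in\mathbb{Z}\}$ is a simple $C^*$-algebra.
   Context: $\mathfrak{B}$ is the universal unital $C^*$-algebra generated by elements $\{b_i : i\in\mathbb{Z}\}$ (with $b_i^\dagger:=b_i^*$) satisfying, for all $i,j\in\mathbb{Z}$, the monotone rules: (1) $b_ib_j=0$ if $i\le j$; (2) $b_ib_jb_j^\dagger=\alpha_{i,j}b_i$; (3) $b_i^\dagger b_i=b_{i-1}b_{i-1}^\dagger-b_ib_i^\dagger$; (4) $b_ib_i^\dagger b_j=b_j-\alpha_{i,j}\sum_{j<k\le i}b_k^\dagger b_kb_j$; where $\alpha_{i,j}=1$ if $i>j$ and $0$ otherwise. Equivalently, $\mathfrak{B}$ is identified, via $b_i\mapsto a_i$, with the unital $C^*$-algebra of operators generated by $\{a_i:i\in\mathbb{Z}\}$ on the monotone Fock space, i.e. the Hilbert space with orthonormal basis consisting of $\Omega$ and $e_{(i_1,\dots,i_k)}$ ($k\ge1$, $i_1<\cdots<i_k$ integers), where $a_i\Omega=0$ and $a_ie_{(i_1,\dots,i_k)}=e_{(i_2,\dots,i_k)}$ if $i=i_1$ (this being $\Omega$ when $k=1$), and $0$ otherwise. $\mathfrak{I}$ is the $C^*$-subalgebra of $\mathfrak{B}$ generated by $\{b_i : i\in\mathbb{Z}\}$ without adjoining the unit of $\mathfrak{B}$. *)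

theory Defs
  imports Complex_Main "HOL-Algebra.Module"
begin

text \<open>
  A (not necessarily unital) C*-algebra is a carrier-based structure: a ring record with a complex
  scalar multiplication, an involution and a norm.  The \<open>one\<close> field is meaningful only
  for unital algebras.
\<close>

record 'a cstar = "(complex, 'a) module" +
  adj :: "'a \<Rightarrow> 'a"
  nrm :: "'a \<Rightarrow> real"

locale cstar_algebra = abelian_group A for A :: "('a, 'm) cstar_scheme" (structure) +
  assumes mult_closed: "\<lbrakk>x \<in> carrier A; y \<in> carrier A\<rbrakk> \<Longrightarrow> x \<otimes> y \<in> carrier A"
    and mult_assoc: "\<lbrakk>x \<in> carrier A; y \<in> carrier A; z \<in> carrier A\<rbrakk>
      \<Longrightarrow> (x \<otimes> y) \<otimes> z = x \<otimes> (y \<otimes> z)"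
    and l_distrib: "\<lbrakk>x \<in> carrier A; y \<in> carrier A; z \<in> carrier A\<rbrakk>
      \<Longrightarrow> (x \<oplus> y) \<otimes> z = x \<otimes> z \<oplus> y \<otimes> z"
    and r_distrib: "\<lbrakk>x \<in> carrier A; y \<in> carrier A; z \<in> carrier A\<rbrakk>
      \<Longrightarrow> z \<otimes> (x \<oplus> y) = z \<otimes> x \<oplus> z \<otimes> y"
    and scale_closed: "x \<in> carrier A \<Longrightarrow> c \<odot> x \<in> carrier A"
    and scale_add_left: "x \<in> carrier A \<Longrightarrow> (c + d) \<odot> x = c \<odot> x \<oplus> d \<odot> x"
    and scale_add_right: "\<lbrakk>x \<in> carrier A; y \<in> carrier A\<rbrakk>
      \<Longrightarrow> c \<odot> (x \<oplus> y) = c \<odot> x \<oplus> c \<odot> y"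
    and scale_scale: "x \<in> carrier A \<Longrightarrow> (c * d) \<odot> x = c \<odot> (d \<odot> x)"
    and scale_one: "x \<in> carrier A \<Longrightarrow> 1 \<odot> x = x"
    and scale_mult_left: "\<lbrakk>x \<in> carrier A; y \<in> carrier A\<rbrakk> \<Longrightarrow> (c \<odot> x) \<otimes> y = c \<odot> (x \<otimes> y)"
    and scale_mult_right: "\<lbrakk>x \<in> carrier A; y \<in> carrier A\<rbrakk> \<Longrightarrow> x \<otimes> (c \<odot> y) = c \<odot> (x \<otimes> y)"
    and adj_closed: "x \<in> carrier A \<Longrightarrow> adj A x \<in> carrier A"
    and adj_adj: "x \<in> carrier A \<Longrightarrow> adj A (adj A x) = x"
    and adj_add: "\<lbrakk>x \<in> carrier A; y \<in> carrier A\<rbrakk> \<Longrightarrow> adj A (x \<oplus> y) = adj A x \<oplus> adj A y"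
    and adj_scale: "x \<in> carrier A \<Longrightarrow> adj A (c \<odot> x) = cnj c \<odot> adj A x"
    and adj_mult: "\<lbrakk>x \<in> carrier A; y \<in> carrier A\<rbrakk> \<Longrightarrow> adj A (x \<otimes> y) = adj A y \<otimes> adj A x"
    and nrm_nonneg: "x \<in> carrier A \<Longrightarrow> 0 \<le> nrm A x"
    and nrm_eq_zero: "x \<in> carrier A \<Longrightarrow> nrm A x = 0 \<longleftrightarrow> x = \<zero>"
    and nrm_triangle: "\<lbrakk>x \<in> carrier A; y \<in> carrier A\<rbrakk> \<Longrightarrow> nrm A (x \<oplus> y) \<le> nrm A x + nrm A y"
    and nrm_scale: "x \<in> carrier A \<Longrightarrow> nrm A (c \<odot> x) = cmod c * nrm A x"
    and nrm_mult: "\<lbrakk>x \<in> carrier A; y \<in> carrier A\<rbrakk> \<Longrightarrow> nrm A (x \<otimes> y) \<le> nrm A x * nrm A y"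
    and cstar_identity: "x \<in> carrier A \<Longrightarrow> nrm A (adj A x \<otimes> x) = (nrm A x)\<^sup>2"
    and nrm_complete: "\<lbrakk>\<And>n :: nat. f n \<in> carrier A;
        \<And>e. 0 < e \<Longrightarrow> \<exists>N. \<forall>m\<ge>N. \<forall>n\<ge>N. nrm A (f m \<ominus> f n) < e\<rbrakk>
      \<Longrightarrow> \<exists>x\<in>carrier A. (\<lambda>n. nrm A (f n \<ominus> x)) \<longlonglongrightarrow> 0"

locale unital_cstar_algebra = cstar_algebra +
  assumes one_mem: "\<one> \<in> carrier A"
    and mult_one_left: "x \<in> carrier A \<Longrightarrow> \<one> \<otimes> x = x"
    and mult_one_right: "x \<in> carrier A \<Longrightarrow> x \<otimes> \<one> = x"

definition nrm_closed :: "('a, 'm) cstar_scheme \<Rightarrow> 'a set \<Rightarrow> bool" where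
  "nrm_closed A S \<longleftrightarrow> (\<forall>(f :: nat \<Rightarrow> 'a) x. (\<forall>n. f n \<in> S) \<and> x \<in> carrier A \<and>
      (\<lambda>n. nrm A (f n \<ominus>\<^bsub>A\<^esub> x)) \<longlonglongrightarrow> 0 \<longrightarrow> x \<in> S)"

definition subspace_of :: "('a, 'm) cstar_scheme \<Rightarrow> 'a set \<Rightarrow> bool" where
  "subspace_of A S \<longleftrightarrow> S \<subseteq> carrier A \<and> \<zero>\<^bsub>A\<^esub> \<in> S \<and>
     (\<forall>x\<in>S. \<forall>y\<in>S. x \<oplus>\<^bsub>A\<^esub> y \<in> S) \<and> (\<forall>c. \<forall>x\<in>S. c \<odot>\<^bsub>A\<^esub> x \<in> S)"

text \<open>A C*-subalgebra is not required to contain the unit.\<close>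

definition cstar_subalgebra :: "('a, 'm) cstar_scheme \<Rightarrow> 'a set \<Rightarrow> bool" where
  "cstar_subalgebra A S \<longleftrightarrow> subspace_of A S \<and> (\<forall>x\<in>S. \<forall>y\<in>S. x \<otimes>\<^bsub>A\<^esub> y \<in> S) \<and>
     (\<forall>x\<in>S. adj A x \<in> S) \<and> nrm_closed A S"

definition cstar_generated :: "('a, 'm) cstar_scheme \<Rightarrow> 'a set \<Rightarrow> 'a set" where
  "cstar_generated A X = \<Inter>{S. cstar_subalgebra A S \<and> X \<subseteq> S}"

definition closed_ideal :: "('a, 'm) cstar_scheme \<Rightarrow> 'a set \<Rightarrow> bool" where
  "closed_ideal A J \<longleftrightarrow> subspace_of A J \<and>
     (\<forall>x\<in>carrier A. \<forall>y\<in>J. x \<otimes>\<^bsub>A\<^esub> y \<in> J \<and> y \<otimes>\<^bsub>A\<^esub> x \<in> J) \<and> nrm_closed A J"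

definition simple_cstar_algebra :: "('a, 'm) cstar_scheme \<Rightarrow> bool" where
  "simple_cstar_algebra A \<longleftrightarrow> cstar_algebra A \<and> carrier A \<noteq> {\<zero>\<^bsub>A\<^esub>} \<and>
     (\<forall>J. closed_ideal A J \<longrightarrow> J = {\<zero>\<^bsub>A\<^esub>} \<or> J = carrier A)"

definition unital_star_hom :: "('a, 'm) cstar_scheme \<Rightarrow> ('b, 'n) cstar_scheme \<Rightarrow> ('a \<Rightarrow> 'b) set" where
  "unital_star_hom A B = {h \<in> ring_hom A B.
     (\<forall>c. \<forall>x\<in>carrier A. h (c \<odot>\<^bsub>A\<^esub> x) = c \<odot>\<^bsub>B\<^esub> h x) \<and>
     (\<forall>x\<in>carrier A. h (adj A x) = adj B (h x))}"

definition mono_alpha :: "int \<Rightarrow> int \<Rightarrow> complex" where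
  "mono_alpha i j = (if i > j then 1 else 0)"

definition monotone_rules :: "('a, 'm) cstar_scheme \<Rightarrow> (int \<Rightarrow> 'a) \<Rightarrow> bool" where
  "monotone_rules A b \<longleftrightarrow>
     (\<forall>i j. i \<le> j \<longrightarrow> b i \<otimes>\<^bsub>A\<^esub> b j = \<zero>\<^bsub>A\<^esub>) \<and>
     (\<forall>i j. b i \<otimes>\<^bsub>A\<^esub> b j \<otimes>\<^bsub>A\<^esub> adj A (b j) = mono_alpha i j \<odot>\<^bsub>A\<^esub> b i) \<and>
     (\<forall>i. adj A (b i) \<otimes>\<^bsub>A\<^esub> b i =
        b (i - 1) \<otimes>\<^bsub>A\<^esub> adj A (b (i - 1)) \<ominus>\<^bsub>A\<^esub> b i \<otimes>\<^bsub>A\<^esub> adj A (b i)) \<and>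
     (\<forall>i j. b i \<otimes>\<^bsub>A\<^esub> adj A (b i) \<otimes>\<^bsub>A\<^esub> b j =
        b j \<ominus>\<^bsub>A\<^esub> mono_alpha i j \<odot>\<^bsub>A\<^esub>
          (\<Oplus>\<^bsub>A\<^esub>k\<in>{j<..i}. adj A (b k) \<otimes>\<^bsub>A\<^esub> b k \<otimes>\<^bsub>A\<^esub> b j))"

text \<open>
  \<open>B\<close> is the universal unital C*-algebra generated by elements \<open>b i\<close> subject to the
  monotone rules.  The universal property is tested on the unital C*-algebras whose carrier is a set
  of functions \<open>nat \<Rightarrow> complex\<close>.  This is no restriction: a countably generated
  C*-algebra has at most continuum many elements, so the C*-subalgebra generated by the unit and
  any family \<open>a i\<close> has an isomorphic copy of that kind.  The map is unique, since
  *-homomorphisms are continuous and \<open>B\<close> is generated by the \<open>b i\<close> and the unit.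
\<close>

definition universal_monotone_algebra :: "('a, 'm) cstar_scheme \<Rightarrow> (int \<Rightarrow> 'a) \<Rightarrow> bool" where
  "universal_monotone_algebra B b \<longleftrightarrow>
     unital_cstar_algebra B \<and> range b \<subseteq> carrier B \<and> monotone_rules B b \<and>
     cstar_generated B (insert \<one>\<^bsub>B\<^esub> (range b)) = carrier B \<and>
     (\<forall>(A :: (nat \<Rightarrow> complex) cstar) a.
        unital_cstar_algebra A \<and> range a \<subseteq> carrier A \<and> monotone_rules A a \<longrightarrow>
        (\<exists>h \<in> unital_star_hom B A. \<forall>i. h (b i) = a i))"

end

theory Submission
  imports Defs "HOL-Analysis.Analysis"
begin

text \<open>
  Put \<open>Q n = b n (b n)\<^sup>*\<close>, a decreasing family of projections with
  \<open>Q (n - 1) = Q n + (b n)\<^sup>* Q n (b n)\<close>.  Iterating this splits \<open>Q (n - k)\<close> into \<open>2 ^ k\<close>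
  projections equivalent to \<open>Q n\<close> through words in the \<open>(b i)\<^sup>*\<close>, so the span of the corresponding
  matrix units is a full matrix algebra (a \<open>block\<close>).  The blocks are directed and contain every
  \<open>b i\<close>; their union is dense in the algebra generated by the \<open>b i\<close>, which is thus an increasing
  limit of simple algebras.  Given \<open>x \<noteq> 0\<close> in a closed ideal, approximate it by \<open>y\<close> in a block,
  choose a column \<open>v\<close> on which \<open>y\<close> nearly attains its norm and put \<open>w = y v\<close>: then \<open>w\<^sup>* x v\<close> is,
  up to a scalar, so close to \<open>Q n\<close> that \<open>Q n\<close> lies in the ideal.  All \<open>Q m\<close> follow, and they are
  local units for the blocks.  That \<open>b 0 \<noteq> 0\<close> is seen on the monotone Fock space
  \<open>\<ell>\<^sup>2\<close>, whose adjointable operators are coded as functions \<open>nat \<Rightarrow> complex\<close>.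
\<close>

section \<open>C*-algebras\<close>

text \<open>If \<open>0 < b < a\<close>, the powers of \<open>a / b\<close> outgrow
  \<open>N\<close>; the instance \<open>j = 0\<close> settles \<open>b = 0\<close>. This strips a
  constant factor, such as a dimension, from an estimate that holds under all repeated
  squarings.\<close>

lemma le_of_power_two_pow_le:
  fixes a b N :: real
  assumes "0 \<le> a" "0 \<le> b" and le: "\<And>j::nat. a ^ (2 ^ j) \<le> N * b ^ (2 ^ j)"
  shows "a \<le> b"
proof (rule ccontr)
  assume "\<not> a \<le> b"
  then have ab: "b < a" by simp
  show False
  proof (cases "b = 0")
    case True
    then have "a ^ (2 ^ 0) \<le> N * 0" using le[of 0] by simp
    then show False using ab True by simp
  next
    case False
    then have b: "b > 0" using assms by simp
    then have "1 < a / b" using ab by simp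
    then obtain m where m: "N < (a / b) ^ m" using real_arch_pow by blast
    have "m \<le> 2 ^ m" by (simp add: less_imp_le)
    then have "(a / b) ^ m \<le> (a / b) ^ (2 ^ m)" using \<open>1 < a / b\<close> by (intro power_increasing) auto
    moreover have "(a / b) ^ (2 ^ m) \<le> N" using le[of m] b by (simp add: power_divide divide_le_eq)
    ultimately show False using m by simp
  qed
qed

context cstar_algebra
begin

lemma scale_zero_left [simp]: "x \<in> carrier A \<Longrightarrow> 0 \<odot> x = \<zero>"
  using scale_add_left[of x 0 0] scale_closed[of x 0] by (simp add: r_neg minus_equality add.l_cancel_one')

lemma a_inv_eq_scale: "x \<in> carrier A \<Longrightarrow> \<ominus> x = (-1) \<odot> x"
proof -
  assume x: "x \<in> carrier A"
  have "(-1) \<odot> x \<oplus> x = 0 \<odot> x" using scale_add_left[OF x, of "-1" 1] scale_one[OF x] by simp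
  then show ?thesis using x by (intro minus_equality) (auto intro: scale_closed)
qed

lemma minus_eq_scale: "\<lbrakk>x \<in> carrier A; y \<in> carrier A\<rbrakk> \<Longrightarrow> x \<ominus> y = x \<oplus> (-1) \<odot> y"
  by (simp add: a_minus_def a_inv_eq_scale)

lemma scale_zero_right [simp]: "c \<odot> \<zero> = \<zero>"
  using scale_scale[of \<zero> c 0] by simp

lemma adj_zero [simp]: "adj A \<zero> = \<zero>"
  using adj_scale[of \<zero> 0] adj_closed[of \<zero>] by simp

lemma nrm_zero [simp]: "nrm A \<zero> = 0"
  using nrm_eq_zero[of \<zero>] by simp

lemma l_distrib_minus:
  "\<lbrakk>x \<in> carrier A; y \<in> carrier A; z \<in> carrier A\<rbrakk> \<Longrightarrow> (x \<ominus> y) \<otimes> z = x \<otimes> z \<ominus> y \<otimes> z"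
  by (simp add: minus_eq_scale l_distrib scale_mult_left scale_closed mult_closed)

lemma r_distrib_minus:
  "\<lbrakk>x \<in> carrier A; y \<in> carrier A; z \<in> carrier A\<rbrakk> \<Longrightarrow> z \<otimes> (x \<ominus> y) = z \<otimes> x \<ominus> z \<otimes> y"
  by (simp add: minus_eq_scale r_distrib scale_mult_right scale_closed mult_closed)

lemma scale_minus:
  "\<lbrakk>x \<in> carrier A; y \<in> carrier A\<rbrakk> \<Longrightarrow> c \<odot> (x \<ominus> y) = c \<odot> x \<ominus> c \<odot> y"
  by (simp add: minus_eq_scale scale_add_right scale_closed flip: scale_scale)

lemma adj_minus:
  "\<lbrakk>x \<in> carrier A; y \<in> carrier A\<rbrakk> \<Longrightarrow> adj A (x \<ominus> y) = adj A x \<ominus> adj A y"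
  by (simp add: minus_eq_scale adj_add adj_scale scale_closed adj_closed)

lemma nrm_minus_commute:
  assumes "x \<in> carrier A" "y \<in> carrier A"
  shows "nrm A (x \<ominus> y) = nrm A (y \<ominus> x)"
proof -
  have "x \<ominus> y = (-1) \<odot> (y \<ominus> x)"
    using assms by (simp add: minus_eq_scale scale_add_right scale_closed a_comm scale_one flip: scale_scale)
  then show ?thesis using assms by (simp add: nrm_scale)
qed

lemma nrm_triangle_minus:
  assumes "x \<in> carrier A" "y \<in> carrier A" "z \<in> carrier A"
  shows "nrm A (x \<ominus> z) \<le> nrm A (x \<ominus> y) + nrm A (y \<ominus> z)"
proof -
  have "x \<ominus> z = (x \<ominus> y) \<oplus> (y \<ominus> z)"
    using assms by (simp add: a_minus_def a_assoc r_neg1)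
  then show ?thesis using assms nrm_triangle[of "x \<ominus> y" "y \<ominus> z"] by simp
qed

lemma nrm_le_nrm_minus:
  assumes "x \<in> carrier A" "y \<in> carrier A"
  shows "nrm A x \<le> nrm A (x \<ominus> y) + nrm A y"
  using nrm_triangle_minus[of x y \<zero>] assms
  by (simp add: minus_eq_scale)

text \<open>The C*-identity bounds the square of \<open>nrm A y\<close> by
  \<open>nrm A (adj A y) * nrm A y\<close>. Cancel one factor, then apply the result to
  \<open>adj A y\<close> as well.\<close>

lemma nrm_adj [simp]:
  assumes x: "x \<in> carrier A"
  shows "nrm A (adj A x) = nrm A x"
proof -
  have le: "nrm A y \<le> nrm A (adj A y)" if y: "y \<in> carrier A" for y
  proof (cases "nrm A y = 0")
    case False
    then have "nrm A y > 0" using nrm_nonneg[OF y] by simp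
    moreover have "nrm A y * nrm A y \<le> nrm A (adj A y) * nrm A y"
      using cstar_identity[OF y] nrm_mult[OF adj_closed[OF y] y] by (simp add: power2_eq_square)
    ultimately show ?thesis by simp
  qed (simp add: nrm_nonneg adj_closed y)
  show ?thesis using le[OF x] le[OF adj_closed[OF x]] by (simp add: adj_adj x)
qed

text \<open>On a projection the C*-identity says that the norm equals its own square, which leaves
  only the values 0 and 1.\<close>

lemma nrm_projection_le_one:
  assumes "p \<in> carrier A" "adj A p = p" "p \<otimes> p = p"
  shows "nrm A p \<le> 1"
proof -
  have "nrm A p = (nrm A p)\<^sup>2" using cstar_identity[OF assms(1)] assms by simp
  then have "nrm A p = 0 \<or> nrm A p = 1" by (simp add: power2_eq_square)
  then show ?thesis by auto
qed

lemma nrm_projection_eq_one: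
  assumes "p \<in> carrier A" "adj A p = p" "p \<otimes> p = p" "p \<noteq> \<zero>"
  shows "nrm A p = 1"
proof -
  have "nrm A p = (nrm A p)\<^sup>2" using cstar_identity[OF assms(1)] assms by simp
  then have "nrm A p = 0 \<or> nrm A p = 1" by (simp add: power2_eq_square)
  then show ?thesis using nrm_eq_zero assms by auto
qed

section \<open>Generated subalgebras, norm closures and restriction of the carrier\<close>

lemma subspaceD:
  assumes "subspace_of A S"
  shows "S \<subseteq> carrier A" "\<zero> \<in> S" "\<lbrakk>x \<in> S; y \<in> S\<rbrakk> \<Longrightarrow> x \<oplus> y \<in> S" "x \<in> S \<Longrightarrow> c \<odot> x \<in> S"
    "\<lbrakk>x \<in> S; y \<in> S\<rbrakk> \<Longrightarrow> x \<ominus> y \<in> S"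
proof -
  show S: "S \<subseteq> carrier A" "\<zero> \<in> S" "\<lbrakk>x \<in> S; y \<in> S\<rbrakk> \<Longrightarrow> x \<oplus> y \<in> S" "x \<in> S \<Longrightarrow> c \<odot> x \<in> S" for x y c
    using assms by (auto simp: subspace_of_def)
  show "x \<ominus> y \<in> S" if "x \<in> S" "y \<in> S"
  proof -
    have "x \<in> carrier A" "y \<in> carrier A" using S(1) that by auto
    then show ?thesis using S(3)[OF that(1) S(4)[OF that(2), of "-1"]] by (simp only: minus_eq_scale)
  qed
qed

lemma cstar_subalgebraD:
  assumes "cstar_subalgebra A S"
  shows "subspace_of A S" "\<lbrakk>x \<in> S; y \<in> S\<rbrakk> \<Longrightarrow> x \<otimes> y \<in> S" "x \<in> S \<Longrightarrow> adj A x \<in> S"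
    "nrm_closed A S"
  using assms by (auto simp: cstar_subalgebra_def)

lemma cstar_subalgebra_generated:
  assumes "X \<subseteq> carrier A"
  shows "cstar_subalgebra A (cstar_generated A X)"
proof -
  \<comment> \<open>The whole carrier belongs to the intersected family, which keeps the
    intersection inside \<open>carrier A\<close>.\<close>
  have "cstar_subalgebra A (carrier A)"
    by (auto simp: cstar_subalgebra_def subspace_of_def nrm_closed_def mult_closed scale_closed adj_closed)
  then have sub: "cstar_generated A X \<subseteq> carrier A" using assms by (auto simp: cstar_generated_def)
  have all: "x \<in> cstar_generated A X \<longleftrightarrow> (\<forall>S. cstar_subalgebra A S \<and> X \<subseteq> S \<longrightarrow> x \<in> S)" for x
    by (auto simp: cstar_generated_def)
  have nc: "nrm_closed A (cstar_generated A X)"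
    unfolding nrm_closed_def
  proof (intro allI impI)
    fix f :: "nat \<Rightarrow> _" and x
    assume f: "(\<forall>n. f n \<in> cstar_generated A X) \<and> x \<in> carrier A \<and> (\<lambda>n. nrm A (f n \<ominus> x)) \<longlonglongrightarrow> 0"
    show "x \<in> cstar_generated A X"
      unfolding all
    proof (intro allI impI)
      fix S assume S: "cstar_subalgebra A S \<and> X \<subseteq> S"
      then have "\<forall>n. f n \<in> S" using f all by blast
      then show "x \<in> S" using S f cstar_subalgebraD(4)[of S] unfolding nrm_closed_def by blast
    qed
  qed
  have "\<zero> \<in> cstar_generated A X" by (auto simp: all cstar_subalgebra_def subspace_of_def)
  moreover have "x \<oplus> y \<in> cstar_generated A X" "x \<otimes> y \<in> cstar_generated A X"
    if "x \<in> cstar_generated A X" "y \<in> cstar_generated A X" for x y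
    using that by (auto simp: all cstar_subalgebra_def subspace_of_def)
  moreover have "c \<odot> x \<in> cstar_generated A X" "adj A x \<in> cstar_generated A X"
    if "x \<in> cstar_generated A X" for x c
    using that by (auto simp: all cstar_subalgebra_def subspace_of_def)
  ultimately show ?thesis using sub nc by (simp add: cstar_subalgebra_def subspace_of_def)
qed

lemma cstar_generated_superset: "X \<subseteq> cstar_generated A X"
  by (auto simp: cstar_generated_def)

lemma cstar_generated_least: "\<lbrakk>cstar_subalgebra A S; X \<subseteq> S\<rbrakk> \<Longrightarrow> cstar_generated A X \<subseteq> S"
  by (auto simp: cstar_generated_def)

text \<open>Approximation is phrased with tolerances although \<open>nrm_closed\<close> is
  sequential: closure under the operations then needs estimates but no choice of sequences.\<close>

definition nrm_closure :: "'a set \<Rightarrow> 'a set" where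
  "nrm_closure S = {x \<in> carrier A. \<forall>e>0. \<exists>y\<in>S. nrm A (x \<ominus> y) < e}"

lemma nrm_closureD: "\<lbrakk>x \<in> nrm_closure S; e > 0\<rbrakk> \<Longrightarrow> \<exists>y\<in>S. nrm A (x \<ominus> y) < e"
  by (auto simp: nrm_closure_def)

lemma nrm_closure_superset: "S \<subseteq> carrier A \<Longrightarrow> S \<subseteq> nrm_closure S"
  unfolding nrm_closure_def by (force simp: a_minus_def r_neg)

lemma cstar_subalgebra_nrm_closure:
  assumes S: "subspace_of A S" and mult: "\<And>x y. \<lbrakk>x \<in> S; y \<in> S\<rbrakk> \<Longrightarrow> x \<otimes> y \<in> S"
    and star: "\<And>x. x \<in> S \<Longrightarrow> adj A x \<in> S"
  shows "cstar_subalgebra A (nrm_closure S)"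
proof -
  note S' = subspaceD[OF S]
  have Sc: "\<And>x. x \<in> S \<Longrightarrow> x \<in> carrier A" using S'(1) by blast
  have sub: "\<And>x. x \<in> nrm_closure S \<Longrightarrow> x \<in> carrier A" by (simp add: nrm_closure_def)
  have add: "x \<oplus> y \<in> nrm_closure S" if xy: "x \<in> nrm_closure S" "y \<in> nrm_closure S" for x y
    unfolding nrm_closure_def
  proof (intro CollectI conjI allI impI)
    show "x \<oplus> y \<in> carrier A" using xy sub by simp
    fix e :: real assume e: "e > 0"
    obtain x' y' where x': "x' \<in> S" "nrm A (x \<ominus> x') < e / 2" and y': "y' \<in> S" "nrm A (y \<ominus> y') < e / 2"
      using nrm_closureD[OF xy(1), of "e/2"] nrm_closureD[OF xy(2), of "e/2"] e by auto
    have c: "x \<in> carrier A" "y \<in> carrier A" "x' \<in> carrier A" "y' \<in> carrier A"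
      using xy sub x' y' Sc by auto
    have "(x \<oplus> y) \<ominus> (x' \<oplus> y') = (x \<ominus> x') \<oplus> (y \<ominus> y')"
      using c by (simp add: a_minus_def minus_add a_ac)
    then have "nrm A ((x \<oplus> y) \<ominus> (x' \<oplus> y')) < e"
      using nrm_triangle[of "x \<ominus> x'" "y \<ominus> y'"] c x'(2) y'(2) by simp
    then show "\<exists>y'\<in>S. nrm A ((x \<oplus> y) \<ominus> y') < e" using S'(3) x' y' by blast
  qed
  have mul: "x \<otimes> y \<in> nrm_closure S" if xy: "x \<in> nrm_closure S" "y \<in> nrm_closure S" for x y
    unfolding nrm_closure_def
  proof (intro CollectI conjI allI impI)
    show "x \<otimes> y \<in> carrier A" using xy sub mult_closed by simp
    fix e :: real assume e: "e > 0"
    have nx: "nrm A x \<ge> 0" and ny: "nrm A y \<ge> 0" using xy sub nrm_nonneg by auto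
    \<comment> \<open>The tolerance \<open>d2\<close> for \<open>y\<close> is fixed only after
      \<open>x'\<close>, because the error in \<open>y\<close> gets multiplied by
      \<open>nrm A x'\<close>. The summand 1 keeps both denominators positive.\<close>
    define d1 where "d1 = e / (2 * (nrm A y + 1))"
    have d1: "d1 > 0" using e ny by (simp add: d1_def)
    obtain x' where x': "x' \<in> S" "nrm A (x \<ominus> x') < d1" using nrm_closureD[OF xy(1) d1] by auto
    have nx': "nrm A x' \<ge> 0" using x' Sc nrm_nonneg by auto
    define d2 where "d2 = e / (2 * (nrm A x' + 1))"
    have d2: "d2 > 0" using e nx' by (simp add: d2_def)
    obtain y' where y': "y' \<in> S" "nrm A (y \<ominus> y') < d2" using nrm_closureD[OF xy(2) d2] by auto
    have c: "x \<in> carrier A" "y \<in> carrier A" "x' \<in> carrier A" "y' \<in> carrier A"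
      using xy sub x' y' Sc by auto
    have "nrm A (x \<otimes> y \<ominus> x' \<otimes> y') \<le> nrm A (x \<otimes> y \<ominus> x' \<otimes> y) + nrm A (x' \<otimes> y \<ominus> x' \<otimes> y')"
      using c by (intro nrm_triangle_minus mult_closed)
    also have "\<dots> = nrm A ((x \<ominus> x') \<otimes> y) + nrm A (x' \<otimes> (y \<ominus> y'))"
      using c by (simp add: l_distrib_minus r_distrib_minus)
    also have "\<dots> \<le> nrm A (x \<ominus> x') * nrm A y + nrm A x' * nrm A (y \<ominus> y')"
      using c by (intro add_mono nrm_mult) auto
    also have "\<dots> \<le> d1 * nrm A y + nrm A x' * d2"
      using x'(2) y'(2) nx' ny by (intro add_mono mult_right_mono mult_left_mono) auto
    also have "\<dots> < e"
    proof -
      have "d1 * nrm A y < d1 * (nrm A y + 1)" "d2 * nrm A x' < d2 * (nrm A x' + 1)"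
        using d1 d2 by auto
      moreover have "d1 * (nrm A y + 1) = e / 2" "d2 * (nrm A x' + 1) = e / 2"
        using ny nx' by (auto simp: d1_def d2_def field_simps)
      ultimately show ?thesis by (simp add: mult.commute)
    qed
    finally show "\<exists>z\<in>S. nrm A (x \<otimes> y \<ominus> z) < e" using mult x' y' by blast
  qed
  have scale: "c \<odot> x \<in> nrm_closure S" if x: "x \<in> nrm_closure S" for c x
    unfolding nrm_closure_def
  proof (intro CollectI conjI allI impI)
    show "c \<odot> x \<in> carrier A" using x sub scale_closed by simp
    fix e :: real assume e: "e > 0"
    then have d: "e / (cmod c + 1) > 0" by (simp add: add_nonneg_pos)
    obtain x' where x': "x' \<in> S" "nrm A (x \<ominus> x') < e / (cmod c + 1)" using nrm_closureD[OF x d] by auto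
    have c: "x \<in> carrier A" "x' \<in> carrier A" using x sub x' Sc by auto
    have "nrm A (c \<odot> x \<ominus> c \<odot> x') = cmod c * nrm A (x \<ominus> x')"
      using c by (simp add: nrm_scale flip: scale_minus)
    also have "\<dots> \<le> cmod c * (e / (cmod c + 1))" using x' by (intro mult_left_mono) auto
    also have "\<dots> < e"
    proof -
      have "cmod c + 1 > 0" by (simp add: add_nonneg_pos)
      then show ?thesis using e by (simp add: field_simps)
    qed
    finally show "\<exists>z\<in>S. nrm A (c \<odot> x \<ominus> z) < e" using S'(4) x' by blast
  qed
  have adj: "adj A x \<in> nrm_closure S" if x: "x \<in> nrm_closure S" for x
    unfolding nrm_closure_def
  proof (intro CollectI conjI allI impI)
    show "adj A x \<in> carrier A" using x sub adj_closed by simp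
    fix e :: real assume e: "e > 0"
    obtain x' where x': "x' \<in> S" "nrm A (x \<ominus> x') < e" using nrm_closureD[OF x e] by auto
    have c: "x \<in> carrier A" "x' \<in> carrier A" using x sub x' Sc by auto
    have "nrm A (adj A x \<ominus> adj A x') < e" using c x' by (simp flip: adj_minus)
    then show "\<exists>z\<in>S. nrm A (adj A x \<ominus> z) < e" using star x' by blast
  qed
  have closed: "nrm_closed A (nrm_closure S)"
    unfolding nrm_closed_def
  proof (intro allI impI)
    fix f :: "nat \<Rightarrow> 'a" and x
    assume f: "(\<forall>n. f n \<in> nrm_closure S) \<and> x \<in> carrier A \<and> (\<lambda>n. nrm A (f n \<ominus> x)) \<longlonglongrightarrow> 0"
    show "x \<in> nrm_closure S"
      unfolding nrm_closure_def
    proof (intro CollectI conjI allI impI)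
      show xc: "x \<in> carrier A" using f by simp
      fix e :: real assume e: "e > 0"
      then have "\<forall>\<^sub>F n in sequentially. nrm A (f n \<ominus> x) < e / 2"
        using f by (intro order_tendstoD(2)[where y = 0]) auto
      then obtain n where n: "nrm A (f n \<ominus> x) < e / 2" by (auto simp: eventually_sequentially)
      obtain y where y: "y \<in> S" "nrm A (f n \<ominus> y) < e / 2" using nrm_closureD[of "f n" S "e/2"] f e by auto
      have c: "f n \<in> carrier A" "y \<in> carrier A" using f sub y Sc by auto
      have "nrm A (x \<ominus> y) < e"
        using nrm_triangle_minus[OF xc c] n y nrm_minus_commute[OF xc c(1)] by simp
      then show "\<exists>y\<in>S. nrm A (x \<ominus> y) < e" using y by blast
    qed
  qed
  have "\<zero> \<in> nrm_closure S" using nrm_closure_superset[OF S'(1)] S'(2) by blast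
  then show ?thesis
    using sub add mul scale adj closed by (simp add: cstar_subalgebra_def subspace_of_def subset_iff)
qed

text \<open>\<open>a_inv\<close> is a description over the carrier, so it must be recomputed when
  the carrier shrinks to \<open>S\<close>. It stays the same because \<open>S\<close> contains the
  multiple by -1 of each of its elements.\<close>

lemma sub_a_inv:
  assumes S: "cstar_subalgebra A S" and x: "x \<in> S"
  shows "a_inv (A\<lparr>carrier := S\<rparr>) x = \<ominus> x"
proof -
  note S' = subspaceD[OF cstar_subalgebraD(1)[OF S]]
  have xc: "x \<in> carrier A" using S' x by blast
  have m: "\<ominus> x \<in> S" using S'(4)[OF x, of "-1"] a_inv_eq_scale[OF xc] by simp
  have "(THE y. y \<in> S \<and> x \<oplus> y = \<zero> \<and> y \<oplus> x = \<zero>) = \<ominus> x"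
  proof (rule the_equality)
    show "\<ominus> x \<in> S \<and> x \<oplus> \<ominus> x = \<zero> \<and> \<ominus> x \<oplus> x = \<zero>" using m xc by (simp add: r_neg l_neg)
    fix y assume "y \<in> S \<and> x \<oplus> y = \<zero> \<and> y \<oplus> x = \<zero>"
    then show "y = \<ominus> x" using minus_equality[of y x] xc S'(1) by auto
  qed
  then show ?thesis by (simp add: a_inv_def m_inv_def)
qed

lemma sub_minus:
  assumes "cstar_subalgebra A S" "y \<in> S"
  shows "x \<ominus>\<^bsub>A\<lparr>carrier := S\<rparr>\<^esub> y = x \<ominus> y"
  using sub_a_inv[OF assms] by (simp add: a_minus_def)

lemma sub_cstar_algebra:
  assumes S: "cstar_subalgebra A S"
  shows "cstar_algebra (A\<lparr>carrier := S\<rparr>)"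
proof -
  note S' = subspaceD[OF cstar_subalgebraD(1)[OF S]]
  have Sc: "\<And>x. x \<in> S \<Longrightarrow> x \<in> carrier A" using S'(1) by blast
  have inv: "\<exists>y\<in>S. y \<oplus> x = \<zero>" if x: "x \<in> S" for x
  proof
    show "(-1) \<odot> x \<in> S" using S'(4)[OF x] .
    show "(-1) \<odot> x \<oplus> x = \<zero>" using a_inv_eq_scale[OF Sc[OF x]] l_neg[OF Sc[OF x]] by simp
  qed
  note closed = S'(2,3,4) cstar_subalgebraD(2,3)[OF S]
  have S: "abelian_group (A\<lparr>carrier := S\<rparr>)"
    by (rule abelian_groupI) (use closed Sc a_assoc a_comm inv in simp_all)
  have ax: "cstar_algebra_axioms (A\<lparr>carrier := S\<rparr>)"
  proof (unfold_locales, goal_cases)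
    \<comment> \<open>Goal 23 is completeness: the limit is taken in \<open>A\<close> and lies in
      \<open>S\<close> because \<open>S\<close> is \<open>nrm_closed\<close>.\<close>
    case (23 f)
    then have f: "\<And>n. f n \<in> S" by simp
    have "\<exists>x\<in>carrier A. (\<lambda>n. nrm A (f n \<ominus> x)) \<longlonglongrightarrow> 0"
      using 23(2) f Sc by (intro nrm_complete) (simp_all add: sub_minus[OF assms])
    then obtain x where x: "x \<in> carrier A" "(\<lambda>n. nrm A (f n \<ominus> x)) \<longlonglongrightarrow> 0" by blast
    then have "x \<in> S" using cstar_subalgebraD(4)[OF assms] f unfolding nrm_closed_def by blast
    with x show ?case by (auto simp: sub_minus[OF assms])
  qed (use closed in \<open>simp_all add: Sc mult_assoc l_distrib r_distrib scale_add_left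
      scale_add_right scale_scale scale_one scale_mult_left scale_mult_right adj_adj adj_add
      adj_scale adj_mult nrm_nonneg nrm_eq_zero nrm_triangle nrm_scale nrm_mult cstar_identity\<close>)
  then show ?thesis using S by (simp add: cstar_algebra_def)
qed

end

section \<open>Families satisfying the monotone rules\<close>

sublocale unital_cstar_algebra \<subseteq> ring A
proof (unfold_locales, goal_cases)
qed (simp_all add: mult_closed mult_assoc one_mem mult_one_left mult_one_right l_distrib r_distrib)

text \<open>The simplicity argument runs on the relations; universality enters at the very end,
  where it shows that \<open>b 0\<close> is not zero.\<close>

locale monotone_family = unital_cstar_algebra A
  for A :: "('a, 'm) cstar_scheme" (structure) and b :: "int \<Rightarrow> 'a" +
  assumes range_subset: "range b \<subseteq> carrier A"
    and rules: "monotone_rules A b"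
begin

lemma b_closed [simp, intro]: "b i \<in> carrier A"
  using range_subset by auto

declare adj_closed [simp, intro] adj_adj [simp] scale_closed [simp, intro]

text \<open>On Fock space \<open>Q i\<close> is the projection onto the span of the basis vectors
  whose indices all exceed \<open>i\<close>, the vacuum included. This is why the family decreases
  in \<open>i\<close>.\<close>

definition Q :: "int \<Rightarrow> 'a" where "Q i = b i \<otimes> adj A (b i)"

lemma Q_closed [simp, intro]: "Q i \<in> carrier A"
  by (simp add: Q_def)

lemma adj_Q [simp]: "adj A (Q i) = Q i"
  by (simp add: Q_def adj_mult)

lemma b_b: "i \<le> j \<Longrightarrow> b i \<otimes> b j = \<zero>"
  using rules by (auto simp: monotone_rules_def)

lemma b_Q: "b i \<otimes> Q j = (if j < i then b i else \<zero>)"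
proof -
  have "b i \<otimes> b j \<otimes> adj A (b j) = mono_alpha i j \<odot> b i"
    using rules by (auto simp: monotone_rules_def)
  then show ?thesis by (simp add: Q_def m_assoc mono_alpha_def scale_one)
qed

text \<open>For \<open>i <= j\<close> the coefficient \<open>mono_alpha i j\<close> in rule (4)
  vanishes and the sum drops out.\<close>

lemma Q_b: "i \<le> j \<Longrightarrow> Q i \<otimes> b j = b j"
  using rules unfolding monotone_rules_def
  by (simp add: Q_def mono_alpha_def minus_eq_scale)

lemma Q_adj_b: "Q j \<otimes> adj A (b i) = (if j < i then adj A (b i) else \<zero>)"
  using arg_cong[OF b_Q[of i j], of "adj A"] by (simp add: adj_mult split: if_splits)

lemma adj_b_Q: "i \<le> j \<Longrightarrow> adj A (b j) \<otimes> Q i = adj A (b j)"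
  using arg_cong[OF Q_b[of i j], of "adj A"] by (simp add: adj_mult)

lemma Q_Q: "i \<le> j \<Longrightarrow> Q i \<otimes> Q j = Q j"
  using Q_b[of i j] by (simp add: Q_def[of j] flip: m_assoc)

lemma Q_Q': "i \<le> j \<Longrightarrow> Q j \<otimes> Q i = Q j"
  using adj_b_Q[of i j] by (simp add: Q_def[of j] m_assoc)

text \<open>Rule (3), with \<open>Q i\<close> inserted between \<open>adj A (b i)\<close> and
  \<open>b i\<close>. The second summand thereby becomes a conjugate of \<open>Q i\<close>, so the
  identity can be iterated.\<close>

lemma Q_pred: "Q (i - 1) = Q i \<oplus> adj A (b i) \<otimes> (Q i \<otimes> b i)"
proof -
  have "adj A (b i) \<otimes> b i = Q (i - 1) \<ominus> Q i"
    using rules by (auto simp: monotone_rules_def Q_def)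
  then have "Q (i - 1) = Q i \<oplus> adj A (b i) \<otimes> b i"
    by (simp add: a_minus_def a_lcomm[of "Q i"] r_neg)
  then show ?thesis by (simp add: Q_b)
qed

lemma nrm_Q_le: "nrm A (Q i) \<le> 1"
  by (rule nrm_projection_le_one) (simp_all add: Q_Q)

lemma nrm_b_le: "nrm A (b i) \<le> 1"
proof -
  have "(nrm A (b i))\<^sup>2 \<le> 1\<^sup>2"
    using cstar_identity[of "adj A (b i)"] nrm_Q_le[of i] by (simp add: Q_def)
  then show ?thesis by (rule power2_le_imp_le) simp
qed

section \<open>The generated algebra, frames of words and scalar corners\<close>

definition gen :: "'a set" where "gen = cstar_generated A (range b)"

lemma gen_subalgebra: "cstar_subalgebra A gen"
  unfolding gen_def by (rule cstar_subalgebra_generated[OF range_subset])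

lemma gen_subspace: "subspace_of A gen"
  using gen_subalgebra by (simp add: cstar_subalgebra_def)

lemma gen_closed:
  "\<zero> \<in> gen" "\<lbrakk>x \<in> gen; y \<in> gen\<rbrakk> \<Longrightarrow> x \<oplus> y \<in> gen" "x \<in> gen \<Longrightarrow> c \<odot> x \<in> gen"
  "\<lbrakk>x \<in> gen; y \<in> gen\<rbrakk> \<Longrightarrow> x \<ominus> y \<in> gen"
  "\<lbrakk>x \<in> gen; y \<in> gen\<rbrakk> \<Longrightarrow> x \<otimes> y \<in> gen" "x \<in> gen \<Longrightarrow> adj A x \<in> gen"
  using subspaceD[OF gen_subspace] cstar_subalgebraD[OF gen_subalgebra] by auto

lemma gen_carrier [simp, intro]: "x \<in> gen \<Longrightarrow> x \<in> carrier A"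
  using subspaceD(1)[OF gen_subspace] by blast

lemma b_gen: "b i \<in> gen"
  unfolding gen_def by (rule subsetD[OF cstar_generated_superset]) simp

lemma Q_gen: "Q i \<in> gen"
  by (simp add: Q_def gen_closed b_gen)

text \<open>Words in the \<open>adj A (b i)\<close> with strictly increasing indices from
  \<open>{n - int k<..n}\<close>, followed by \<open>Q n\<close>; each new letter has a smaller
  index and goes in front. These at most \<open>2 ^ k\<close> elements are partial isometries
  carrying \<open>Q n\<close> onto the pieces of \<open>Q (n - int k)\<close>.\<close>

primrec frame :: "int \<Rightarrow> nat \<Rightarrow> 'a set" where
  "frame n 0 = {Q n}"
| "frame n (Suc k) = frame n k \<union> (\<lambda>v. adj A (b (n - int k)) \<otimes> v) ` frame n k"

lemma frame_gen: "e \<in> frame n k \<Longrightarrow> e \<in> gen"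
  by (induction k arbitrary: e) (auto simp: Q_gen gen_closed b_gen)

lemma frame_carrier [simp, intro]: "e \<in> frame n k \<Longrightarrow> e \<in> carrier A"
  using frame_gen by blast

lemma frame_Q: "e \<in> frame n k \<Longrightarrow> e \<otimes> Q n = e"
proof (induction k arbitrary: e)
  case (Suc k)
  then show ?case by (auto simp: m_assoc)
qed (simp add: Q_Q)

lemma Q_frame: "\<lbrakk>e \<in> frame n k; m \<le> n - int k\<rbrakk> \<Longrightarrow> Q m \<otimes> e = e"
proof (induction k arbitrary: e)
  case (Suc k)
  then have "Q m \<otimes> adj A (b (n - int k)) = adj A (b (n - int k))"
    by (simp add: Q_adj_b)
  with Suc show ?case by (auto simp flip: m_assoc)
qed (simp add: Q_Q)

text \<open>\<open>e\<close> absorbs \<open>Q (n - int k)\<close> on its left, and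
  \<open>b i\<close> kills \<open>Q i\<close>. This makes the two halves of
  \<open>frame n (Suc k)\<close> orthogonal.\<close>

lemma b_frame: "e \<in> frame n k \<Longrightarrow> b (n - int k) \<otimes> e = \<zero>"
  using Q_frame[of e n k "n - int k"] m_assoc[of "b (n - int k)" "Q (n - int k)" e]
  by (simp add: b_Q)

lemma b_adj_b_frame:
  assumes "e \<in> frame n k"
  shows "b (n - int k) \<otimes> (adj A (b (n - int k)) \<otimes> e) = e"
  using Q_frame[of e n k "n - int k"] assms by (simp add: Q_def m_assoc)

text \<open>The scalars of the matrix picture, with \<open>Q n\<close> as their unit. Matrix entries
  and inner products are only required to lie here, so no coefficients have to be named.\<close>

definition corner :: "int \<Rightarrow> 'a set" where "corner n = range (\<lambda>c. c \<odot> Q n)"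

lemma corner_iff: "x \<in> corner n \<longleftrightarrow> (\<exists>c. x = c \<odot> Q n)"
  by (auto simp: corner_def)

lemma corner_carrier [simp, intro]: "x \<in> corner n \<Longrightarrow> x \<in> carrier A"
  by (auto simp: corner_def)

lemma corner_Q: "Q n \<in> corner n"
  unfolding corner_def by (rule range_eqI[of _ _ 1]) (simp add: scale_one)

lemma corner_zero: "\<zero> \<in> corner n"
  unfolding corner_def by (rule range_eqI[of _ _ 0]) simp

lemma corner_add: "\<lbrakk>x \<in> corner n; y \<in> corner n\<rbrakk> \<Longrightarrow> x \<oplus> y \<in> corner n"
  by (auto simp: corner_def simp flip: scale_add_left)

lemma corner_scale: "x \<in> corner n \<Longrightarrow> c \<odot> x \<in> corner n"
  by (auto simp: corner_def simp flip: scale_scale)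

lemma corner_mult: "\<lbrakk>x \<in> corner n; y \<in> corner n\<rbrakk> \<Longrightarrow> x \<otimes> y \<in> corner n"
  unfolding corner_iff by (auto simp: scale_mult_left scale_mult_right Q_Q simp flip: scale_scale)

lemma corner_adj: "x \<in> corner n \<Longrightarrow> adj A x \<in> corner n"
  unfolding corner_iff by (auto simp: adj_scale)

text \<open>Induction on the first letter: if just one of the two words has it, the product vanishes
  by \<open>b_frame\<close>; if both have it, it cancels by \<open>b_adj_b_frame\<close>.\<close>

lemma frame_orth: "\<lbrakk>u \<in> frame n k; v \<in> frame n k\<rbrakk> \<Longrightarrow> adj A u \<otimes> v \<in> corner n"
proof (induction k arbitrary: u v)
  case (Suc k)
  let ?i = "n - int k"
  have 1: "adj A u \<otimes> v \<in> corner n" if "u \<in> frame n k" "v \<in> frame n k" for u v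
    using Suc.IH that .
  have 2: "adj A u \<otimes> (adj A (b ?i) \<otimes> v) = \<zero>" if "u \<in> frame n k" "v \<in> frame n k" for u v
  proof -
    have "adj A u \<otimes> adj A (b ?i) = \<zero>"
      using arg_cong[OF b_frame[OF that(1)], of "adj A"] that by (simp add: adj_mult)
    then show ?thesis using that by (simp flip: m_assoc)
  qed
  have 3: "adj A u \<otimes> (b ?i \<otimes> v) = \<zero>" if "u \<in> frame n k" "v \<in> frame n k" for u v
    using that by (simp add: b_frame)
  have 4: "adj A u \<otimes> (b ?i \<otimes> (adj A (b ?i) \<otimes> v)) = adj A u \<otimes> v" if "u \<in> frame n k" "v \<in> frame n k" for u v
    using that by (simp add: b_adj_b_frame)
  show ?case
    using Suc.prems by (auto simp: 1 2 3 4 adj_mult m_assoc corner_zero)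
qed (auto simp: Q_Q corner_Q)

text \<open>The elements of a frame resolve the projection below it: \<open>Q (n - k) = \<Sum>r. r r\<^sup>*\<close>.\<close>

lemma frame_mult:
  assumes "x \<in> carrier A" "z \<in> carrier A"
    and "\<And>r. r \<in> frame n k \<Longrightarrow> x \<otimes> r \<in> corner n"
    and "\<And>r. r \<in> frame n k \<Longrightarrow> adj A r \<otimes> z \<in> corner n"
  shows "x \<otimes> (Q (n - int k) \<otimes> z) \<in> corner n"
  using assms
proof (induction k arbitrary: x z)
  case 0
  then have "(x \<otimes> Q n) \<otimes> (Q n \<otimes> z) \<in> corner n" using corner_mult by simp
  moreover have "(x \<otimes> Q n) \<otimes> (Q n \<otimes> z) = x \<otimes> ((Q n \<otimes> Q n) \<otimes> z)"
    using 0 by (simp add: m_assoc)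
  ultimately show ?case by (simp add: Q_Q)
next
  case (Suc k)
  let ?i = "n - int k"
  have "x \<otimes> (Q ?i \<otimes> z) \<in> corner n" using Suc by auto
  \<comment> \<open>This is the second summand of \<open>Q_pred\<close>. Moving
    \<open>adj A (b ?i)\<close> to \<open>x\<close> and \<open>b ?i\<close> to \<open>z\<close>
    turns the hypotheses on the new words of the frame into those of the induction
    hypothesis.\<close>
  moreover have "(x \<otimes> adj A (b ?i)) \<otimes> (Q ?i \<otimes> (b ?i \<otimes> z)) \<in> corner n"
  proof (rule Suc.IH)
    fix r assume r: "r \<in> frame n k"
    show "(x \<otimes> adj A (b ?i)) \<otimes> r \<in> corner n"
      using Suc.prems(3)[of "adj A (b ?i) \<otimes> r"] r Suc.prems(1) by (simp add: m_assoc)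
    show "adj A r \<otimes> (b ?i \<otimes> z) \<in> corner n"
      using Suc.prems(4)[of "adj A (b ?i) \<otimes> r"] r Suc.prems(2) by (simp add: m_assoc adj_mult)
  qed (use Suc.prems in auto)
  moreover have "x \<otimes> (Q (n - int (Suc k)) \<otimes> z) =
      x \<otimes> (Q ?i \<otimes> z) \<oplus> (x \<otimes> adj A (b ?i)) \<otimes> (Q ?i \<otimes> (b ?i \<otimes> z))"
  proof -
    have "n - int (Suc k) = ?i - 1" by simp
    then show ?thesis using Suc.prems(1,2) by (simp only: Q_pred) (simp add: l_distr r_distr m_assoc)
  qed
  ultimately show ?case using corner_add by simp
qed

text \<open>Each use of \<open>Q_pred\<close> splits the projection in two and so doubles the bound.
  The factor \<open>2 ^ k\<close> is crude but depends only on the size of the frame; it disappears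
  later by taking powers.\<close>

lemma nrm_mult_Q_le:
  assumes "x \<in> carrier A" "0 \<le> K" and "\<And>r. r \<in> frame n k \<Longrightarrow> nrm A (x \<otimes> r) \<le> K"
  shows "nrm A (x \<otimes> Q (n - int k)) \<le> 2 ^ k * K"
  using assms
proof (induction k arbitrary: x)
  case 0
  then show ?case by simp
next
  case (Suc k)
  let ?i = "n - int k"
  have 1: "nrm A (x \<otimes> Q ?i) \<le> 2 ^ k * K" using Suc by auto
  have 2: "nrm A ((x \<otimes> adj A (b ?i)) \<otimes> Q ?i) \<le> 2 ^ k * K"
  proof (rule Suc.IH)
    fix r assume r: "r \<in> frame n k"
    show "nrm A ((x \<otimes> adj A (b ?i)) \<otimes> r) \<le> K"
      using Suc.prems(3)[of "adj A (b ?i) \<otimes> r"] r Suc.prems(1) by (simp add: m_assoc)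
  qed (use Suc.prems in auto)
  have "x \<otimes> Q (n - int (Suc k)) = x \<otimes> Q ?i \<oplus> ((x \<otimes> adj A (b ?i)) \<otimes> Q ?i) \<otimes> b ?i"
  proof -
    have "n - int (Suc k) = ?i - 1" by simp
    then show ?thesis using Suc.prems(1,2) by (simp only: Q_pred) (simp add: r_distr m_assoc)
  qed
  then have "nrm A (x \<otimes> Q (n - int (Suc k))) \<le>
      nrm A (x \<otimes> Q ?i) + nrm A (((x \<otimes> adj A (b ?i)) \<otimes> Q ?i) \<otimes> b ?i)"
    using Suc.prems nrm_triangle by simp
  also have "nrm A (((x \<otimes> adj A (b ?i)) \<otimes> Q ?i) \<otimes> b ?i) \<le> nrm A ((x \<otimes> adj A (b ?i)) \<otimes> Q ?i) * 1"
    using Suc.prems nrm_b_le[of ?i]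
    by (intro order_trans[OF nrm_mult] mult_left_mono nrm_nonneg) auto
  finally show ?case using 1 2 by simp
qed

section \<open>Blocks as matrix algebras, and the columns they act on\<close>

definition block :: "int \<Rightarrow> nat \<Rightarrow> 'a set" where
  "block n k = {y \<in> gen. Q (n - int k) \<otimes> y = y \<and> y \<otimes> Q (n - int k) = y \<and>
     (\<forall>u\<in>frame n k. \<forall>v\<in>frame n k. adj A u \<otimes> (y \<otimes> v) \<in> corner n)}"

text \<open>The vectors on which \<open>block n k\<close> acts, realised inside the algebra, with
  inner product \<open>adj A v\<close> times \<open>w\<close>. Like blocks they are described by
  coordinates against the frame and not as spans, which avoids finite sums over the frame.\<close>

definition columns :: "int \<Rightarrow> nat \<Rightarrow> 'a set" where
  "columns n k = {v \<in> gen. Q (n - int k) \<otimes> v = v \<and> v \<otimes> Q n = v \<and>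
     (\<forall>u\<in>frame n k. adj A u \<otimes> v \<in> corner n)}"

lemma blockD:
  assumes "y \<in> block n k"
  shows "y \<in> gen" "y \<in> carrier A" "Q (n - int k) \<otimes> y = y" "y \<otimes> Q (n - int k) = y"
    "\<lbrakk>u \<in> frame n k; v \<in> frame n k\<rbrakk> \<Longrightarrow> adj A u \<otimes> (y \<otimes> v) \<in> corner n"
  using assms by (auto simp: block_def)

lemma columnsD:
  assumes "v \<in> columns n k"
  shows "v \<in> gen" "v \<in> carrier A" "Q (n - int k) \<otimes> v = v" "v \<otimes> Q n = v"
    "u \<in> frame n k \<Longrightarrow> adj A u \<otimes> v \<in> corner n"
  using assms by (auto simp: columns_def)

lemma frame_columns: "e \<in> frame n k \<Longrightarrow> e \<in> columns n k"
  by (simp add: columns_def frame_gen Q_frame frame_Q frame_orth)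

text \<open>A Parseval argument: \<open>w\<close> absorbs \<open>Q (n - int k)\<close>, and
  resolving that projection by \<open>frame_mult\<close> reduces the product to the coordinates of
  \<open>v\<close> and \<open>w\<close>.\<close>

lemma columns_inner:
  assumes v: "v \<in> columns n k" and w: "w \<in> columns n k"
  shows "adj A v \<otimes> w \<in> corner n"
proof -
  have "adj A v \<otimes> (Q (n - int k) \<otimes> w) \<in> corner n"
  proof (rule frame_mult)
    fix r assume r: "r \<in> frame n k"
    have "adj A (adj A r \<otimes> v) \<in> corner n" using columnsD(5)[OF v r] by (rule corner_adj)
    then show "adj A v \<otimes> r \<in> corner n" using r columnsD[OF v] by (simp add: adj_mult)
  qed (use columnsD[OF v] columnsD[OF w] in auto)
  then show ?thesis using columnsD[OF w] by simp
qed

lemma block_mult_columns: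
  assumes y: "y \<in> block n k" and v: "v \<in> columns n k"
  shows "y \<otimes> v \<in> columns n k"
proof -
  note Y = blockD[OF y] and V = columnsD[OF v]
  have "adj A u \<otimes> (y \<otimes> v) \<in> corner n" if u: "u \<in> frame n k" for u
  proof -
    have "(adj A u \<otimes> y) \<otimes> (Q (n - int k) \<otimes> v) \<in> corner n"
      by (rule frame_mult) (use u Y V in \<open>auto simp: m_assoc\<close>)
    then show ?thesis using u Y V by (simp add: m_assoc)
  qed
  moreover have "Q (n - int k) \<otimes> (y \<otimes> v) = y \<otimes> v" using Y V by (simp flip: m_assoc)
  ultimately show ?thesis using Y V by (simp add: columns_def gen_closed m_assoc)
qed

lemma block_frame_columns: "\<lbrakk>y \<in> block n k; e \<in> frame n k\<rbrakk> \<Longrightarrow> y \<otimes> e \<in> columns n k"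
  by (simp add: block_mult_columns frame_columns)

lemma block_zero: "\<zero> \<in> block n k"
  by (auto simp: block_def gen_closed corner_zero)

lemma block_add: "\<lbrakk>x \<in> block n k; y \<in> block n k\<rbrakk> \<Longrightarrow> x \<oplus> y \<in> block n k"
  by (auto simp: block_def gen_closed l_distr r_distr intro!: corner_add)

lemma block_scale: "x \<in> block n k \<Longrightarrow> c \<odot> x \<in> block n k"
  by (auto simp: block_def gen_closed scale_mult_left scale_mult_right intro!: corner_scale)

lemma block_adj:
  assumes x: "x \<in> block n k"
  shows "adj A x \<in> block n k"
proof -
  note X = blockD[OF x]
  have "adj A u \<otimes> (adj A x \<otimes> v) \<in> corner n" if u: "u \<in> frame n k" and v: "v \<in> frame n k" for u v
    using corner_adj[OF X(5)[OF v u]] X(2) u v by (simp add: adj_mult m_assoc)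
  moreover have "Q (n - int k) \<otimes> adj A x = adj A x" "adj A x \<otimes> Q (n - int k) = adj A x"
    using arg_cong[OF X(4), of "adj A"] arg_cong[OF X(3), of "adj A"] X(2) by (simp_all add: adj_mult)
  ultimately show ?thesis using X by (simp add: block_def gen_closed)
qed

lemma block_mult:
  assumes x: "x \<in> block n k" and y: "y \<in> block n k"
  shows "x \<otimes> y \<in> block n k"
proof -
  note X = blockD[OF x] and Y = blockD[OF y]
  have "adj A u \<otimes> ((x \<otimes> y) \<otimes> v) \<in> corner n" if u: "u \<in> frame n k" and v: "v \<in> frame n k" for u v
    using columnsD(5)[OF block_mult_columns[OF x block_frame_columns[OF y v]] u] X Y v
    by (simp add: m_assoc)
  moreover have "Q (n - int k) \<otimes> (x \<otimes> y) = x \<otimes> y" "(x \<otimes> y) \<otimes> Q (n - int k) = x \<otimes> y"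
    using X Y by (simp add: m_assoc[symmetric], simp add: m_assoc)
  ultimately show ?thesis using X Y by (simp add: block_def gen_closed)
qed

text \<open>The corner embedding of \<open>y\<close> as a block-diagonal matrix with second entry
  zero. \<open>y\<close> lives under \<open>Q (n - int k)\<close>, and this projection annihilates
  the new letter \<open>adj A (b (n - int k))\<close>.\<close>

lemma block_Suc: "block n k \<subseteq> block n (Suc k)"
proof
  fix y assume y: "y \<in> block n k"
  note Y = blockD[OF y]
  let ?i = "n - int k"
  have i: "n - int (Suc k) = ?i - 1" by simp
  have Q: "Q (?i - 1) \<otimes> y = y" "y \<otimes> Q (?i - 1) = y"
    using Y(2,3,4) Q_Q[of "?i - 1" ?i] Q_Q'[of "?i - 1" ?i] m_assoc[of "Q (?i - 1)" "Q ?i" y]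
      m_assoc[of y "Q ?i" "Q (?i - 1)"] by simp_all
  have yb: "y \<otimes> adj A (b ?i) = \<zero>"
    using Y(2,4) m_assoc[of y "Q ?i" "adj A (b ?i)"] by (simp add: Q_adj_b)
  have "b ?i \<otimes> y = \<zero>"
    using Y(2,3) m_assoc[of "b ?i" "Q ?i" y] by (simp add: b_Q)
  then have bv: "b ?i \<otimes> (y \<otimes> v) = \<zero>" if "v \<in> carrier A" for v
    using that Y(2) by (simp flip: m_assoc)
  have yb': "y \<otimes> (adj A (b ?i) \<otimes> v) = \<zero>" if "v \<in> carrier A" for v
    using that Y(2) yb by (simp flip: m_assoc)
  show "y \<in> block n (Suc k)"
    using Y Q unfolding block_def i
    by (auto simp: adj_mult m_assoc bv yb' corner_zero)
qed

text \<open>Raising \<open>n\<close> and \<open>k\<close> together keeps the lower end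
  \<open>n - int k\<close> and refines the innermost factor: \<open>Q n\<close> is replaced by
  \<open>Q (n + 1)\<close> or by one further letter.\<close>

lemma frame_split:
  "e \<in> frame (n + 1) (Suc k) \<Longrightarrow>
    \<exists>e'\<in>frame n k. e = e' \<otimes> Q (n + 1) \<or> e = e' \<otimes> adj A (b (n + 1))"
proof (induction k arbitrary: e)
  case 0
  then show ?case by (auto simp: Q_Q Q_adj_b adj_b_Q)
next
  case (Suc k)
  consider "e \<in> frame (n + 1) (Suc k)"
    | v where "v \<in> frame (n + 1) (Suc k)" "e = adj A (b (n - int k)) \<otimes> v"
    using Suc.prems by auto
  then show ?case
  proof cases
    case 1
    then obtain e' where "e' \<in> frame n k" "e = e' \<otimes> Q (n + 1) \<or> e = e' \<otimes> adj A (b (n + 1))"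
      using Suc.IH by blast
    moreover from this have "e' \<in> frame n (Suc k)" by simp
    ultimately show ?thesis by blast
  next
    case 2
    then obtain v' where v': "v' \<in> frame n k" "v = v' \<otimes> Q (n + 1) \<or> v = v' \<otimes> adj A (b (n + 1))"
      using Suc.IH by blast
    then have "adj A (b (n - int k)) \<otimes> v' \<in> frame n (Suc k)" by simp
    moreover have "e = (adj A (b (n - int k)) \<otimes> v') \<otimes> Q (n + 1) \<or>
        e = (adj A (b (n - int k)) \<otimes> v') \<otimes> adj A (b (n + 1))"
      using 2 v' by (auto simp: m_assoc)
    ultimately show ?thesis by blast
  qed
qed

text \<open>The amplification of a matrix: by \<open>frame_split\<close> each entry \<open>c\<close>
  turns into \<open>c\<close> times a two by two identity matrix over
  \<open>corner (n + 1)\<close>.\<close>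

lemma block_Suc_Suc: "block n k \<subseteq> block (n + 1) (Suc k)"
proof
  fix y assume y: "y \<in> block n k"
  note Y = blockD[OF y]
  have i: "n + 1 - int (Suc k) = n - int k" by simp
  \<comment> \<open>The four compressions of \<open>Q n\<close>: \<open>Q (n + 1)\<close> when the
    two factors agree, zero when they differ.\<close>
  have z: "adj A x \<otimes> (Q n \<otimes> x') \<in> corner (n + 1)"
    if "x \<in> {Q (n + 1), adj A (b (n + 1))}" "x' \<in> {Q (n + 1), adj A (b (n + 1))}" for x x'
    using that b_adj_b_frame[of "Q (n + 1)" "n + 1" 0]
    by (auto simp: Q_Q Q_adj_b b_Q corner_Q corner_zero simp flip: Q_def)
  have "adj A u \<otimes> (y \<otimes> v) \<in> corner (n + 1)"
    if uv: "u \<in> frame (n + 1) (Suc k)" "v \<in> frame (n + 1) (Suc k)" for u v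
  proof -
    obtain u' x where u': "u' \<in> frame n k" "x \<in> {Q (n + 1), adj A (b (n + 1))}" "u = u' \<otimes> x"
      using frame_split[OF uv(1)] by blast
    obtain v' x' where v': "v' \<in> frame n k" "x' \<in> {Q (n + 1), adj A (b (n + 1))}" "v = v' \<otimes> x'"
      using frame_split[OF uv(2)] by blast
    have x: "x \<in> carrier A" "x' \<in> carrier A" using u' v' by auto
    obtain c where c: "adj A u' \<otimes> (y \<otimes> v') = c \<odot> Q n" using Y(5)[OF u'(1) v'(1)] corner_iff by blast
    have "adj A u \<otimes> (y \<otimes> v) = adj A x \<otimes> ((adj A u' \<otimes> (y \<otimes> v')) \<otimes> x')"
      using x u' v' Y(2) by (simp add: adj_mult m_assoc)
    also have "\<dots> = c \<odot> (adj A x \<otimes> (Q n \<otimes> x'))"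
      using x by (simp add: c scale_mult_left scale_mult_right)
    finally show ?thesis using corner_scale z u' v' by simp
  qed
  then show "y \<in> block (n + 1) (Suc k)"
    using Y unfolding block_def i by simp
qed

lemma block_mono: "k \<le> k' \<Longrightarrow> block n k \<subseteq> block n k'"
  by (rule lift_Suc_mono_le) (rule block_Suc)

lemma block_up: "block n k \<subseteq> block (n + int m) (k + m)"
proof (induction m)
  case (Suc m)
  have "block (n + int m) (k + m) \<subseteq> block (n + int (Suc m)) (k + Suc m)"
    using block_Suc_Suc[of "n + int m" "k + m"] by (simp add: ac_simps)
  with Suc show ?case by (rule subset_trans)
qed simp

text \<open>For the frame consisting of \<open>Q i\<close> and \<open>adj A (b i)\<close>,
  \<open>b i\<close> is a two by two matrix unit: its only possibly nonzero entry is
  \<open>b i\<close> times \<open>adj A (b i)\<close>, that is \<open>Q i\<close>.\<close>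

lemma b_block: "b i \<in> block i 1"
proof -
  have "frame i 1 = {Q i, adj A (b i)}" by (auto simp: adj_b_Q)
  moreover have "b i \<otimes> adj A (b i) = Q i" by (simp add: Q_def)
  ultimately show ?thesis
    by (auto simp: block_def b_gen Q_b b_Q Q_Q corner_zero corner_Q b_b)
qed

section \<open>Directedness and density of the union of the blocks\<close>

definition blocks :: "'a set" where "blocks = (\<Union>n k. block n k)"

lemma blocks_directed:
  assumes "x \<in> blocks" "y \<in> blocks"
  shows "\<exists>n k. x \<in> block n k \<and> y \<in> block n k"
proof -
  obtain n k n' k' where x: "x \<in> block n k" and y: "y \<in> block n' k'"
    using assms by (auto simp: blocks_def)
  \<comment> \<open>First \<open>block_up\<close> brings both upper ends to \<open>m\<close>,
    keeping the lower ends; then \<open>block_mono\<close> extends both blocks downwards to a common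
    size.\<close>
  define m where "m = max n n'"
  have "x \<in> block m (k + nat (m - n))" "y \<in> block m (k' + nat (m - n'))"
    using x y block_up[of n k "nat (m - n)"] block_up[of n' k' "nat (m - n')"] by (auto simp: m_def)
  then have "x \<in> block m (k + nat (m - n) + (k' + nat (m - n')))"
    "y \<in> block m (k + nat (m - n) + (k' + nat (m - n')))"
    using block_mono le_add1 le_add2 by blast+
  then show ?thesis by blast
qed

lemma blocks_gen: "blocks \<subseteq> gen"
  by (auto simp: blocks_def block_def)

lemma gen_subset_closure: "gen \<subseteq> nrm_closure blocks"
proof -
  have "cstar_subalgebra A (nrm_closure blocks)"
  proof (rule cstar_subalgebra_nrm_closure)
    have 1: "x \<oplus> y \<in> blocks" "x \<otimes> y \<in> blocks" if xy: "x \<in> blocks" "y \<in> blocks" for x y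
    proof -
      obtain n k where "x \<in> block n k" "y \<in> block n k" using blocks_directed xy by blast
      then have "x \<oplus> y \<in> block n k" "x \<otimes> y \<in> block n k" by (auto intro: block_add block_mult)
      then show "x \<oplus> y \<in> blocks" "x \<otimes> y \<in> blocks" by (auto simp: blocks_def)
    qed
    have 2: "c \<odot> x \<in> blocks" "adj A x \<in> blocks" if "x \<in> blocks" for c x
    proof -
      obtain n k where "x \<in> block n k" using \<open>x \<in> blocks\<close> by (auto simp: blocks_def)
      then have "c \<odot> x \<in> block n k" "adj A x \<in> block n k" by (auto intro: block_scale block_adj)
      then show "c \<odot> x \<in> blocks" "adj A x \<in> blocks" by (auto simp: blocks_def)
    qed
    have 3: "\<zero> \<in> blocks" using block_zero by (auto simp: blocks_def)
    show "subspace_of A blocks"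
      unfolding subspace_of_def using 1 2 3 blocks_gen by auto
    show "x \<otimes> y \<in> blocks" if "x \<in> blocks" "y \<in> blocks" for x y using 1(2) that .
    show "adj A x \<in> blocks" if "x \<in> blocks" for x using 2(2) that .
  qed
  moreover have "range b \<subseteq> nrm_closure blocks"
  proof -
    have "range b \<subseteq> blocks" using b_block by (auto simp: blocks_def)
    moreover have "blocks \<subseteq> nrm_closure blocks"
      by (rule nrm_closure_superset) (use blocks_gen in auto)
    ultimately show ?thesis by blast
  qed
  ultimately show ?thesis unfolding gen_def by (rule cstar_generated_least)
qed

section \<open>Norms of block elements, computed on columns\<close>

lemma nrm_frame_le: "r \<in> frame n k \<Longrightarrow> nrm A r \<le> 1"
proof (induction k arbitrary: r)
  case (Suc k)
  have "nrm A (adj A (b (n - int k)) \<otimes> v) \<le> 1" if v: "v \<in> frame n k" for v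
  proof -
    have "nrm A (adj A (b (n - int k)) \<otimes> v) \<le> nrm A (b (n - int k)) * nrm A v"
      using nrm_mult[of "adj A (b (n - int k))" v] v by simp
    also have "\<dots> \<le> 1 * 1" using v Suc.IH[OF v] nrm_b_le by (intro mult_mono nrm_nonneg) auto
    finally show ?thesis by simp
  qed
  then show ?case using Suc by auto
qed (simp add: nrm_Q_le)

text \<open>A crude bound for all powers of \<open>y\<^sup>* y\<close> turns into a sharp one by the C*-identity; this
  amounts to the uniqueness of the C*-norm on a matrix algebra, without the spectral theorem.\<close>

lemma nrm_block_le:
  assumes y: "y \<in> block n k" and K: "0 \<le> K"
    and le: "\<And>v. v \<in> columns n k \<Longrightarrow> nrm A (y \<otimes> v) \<le> K * nrm A v"
  shows "nrm A y \<le> K"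
proof -
  \<comment> \<open>\<open>t j\<close> is the power with exponent \<open>2 ^ j\<close> of
    \<open>adj A y\<close> times \<open>y\<close>. Each term is self-adjoint, so the C*-identity
    makes its norm square exactly at every step.\<close>
  define t where "t = rec_nat (adj A y \<otimes> y) (\<lambda>_ x. x \<otimes> x)"
  have t0: "t 0 = adj A y \<otimes> y" and tS: "t (Suc j) = t j \<otimes> t j" for j by (simp_all add: t_def)
  note Y = blockD[OF y]
  have base: "nrm A (t 0 \<otimes> v) \<le> K\<^sup>2 * nrm A v" if v: "v \<in> columns n k" for v
  proof -
    \<comment> \<open>The bound passes from \<open>y\<close> to its adjoint: the squared norm of
      \<open>z\<close> is the norm of \<open>adj A w\<close> times \<open>y\<close> times
      \<open>z\<close>, hence at most \<open>nrm A w * (K * nrm A z)\<close>, and a factor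
      \<open>nrm A z\<close> cancels.\<close>
    define w where "w = y \<otimes> v"
    define z where "z = adj A y \<otimes> w"
    have w: "w \<in> columns n k" using block_mult_columns[OF y v] by (simp add: w_def)
    have z: "z \<in> columns n k" using block_mult_columns[OF block_adj[OF y] w] by (simp add: z_def)
    note W = columnsD(2)[OF w] and Z = columnsD(2)[OF z]
    have "(nrm A z)\<^sup>2 = nrm A (adj A w \<otimes> (y \<otimes> z))"
      using cstar_identity[OF Z] W Z Y(2) by (simp add: z_def adj_mult m_assoc)
    also have "\<dots> \<le> nrm A w * nrm A (y \<otimes> z)" using nrm_mult[of "adj A w" "y \<otimes> z"] W Z Y(2) by simp
    also have "\<dots> \<le> nrm A w * (K * nrm A z)" using le[OF z] nrm_nonneg[OF W] by (rule mult_left_mono)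
    finally have sq: "nrm A z * nrm A z \<le> (K * nrm A w) * nrm A z" by (simp add: power2_eq_square ac_simps)
    have "nrm A z \<le> K * nrm A w"
    proof (cases "nrm A z = 0")
      case True
      then show ?thesis using K nrm_nonneg[OF W] by simp
    next
      case False
      then have "nrm A z > 0" using nrm_nonneg[OF Z] by simp
      then show ?thesis using sq by simp
    qed
    also have "\<dots> \<le> K * (K * nrm A v)" using le[OF v] K by (intro mult_left_mono) (auto simp: w_def)
    finally show ?thesis
      using Y(2) columnsD(2)[OF v] by (simp add: z_def w_def t0 m_assoc power2_eq_square)
  qed
  have t: "t j \<in> block n k \<and> adj A (t j) = t j \<and> nrm A (t j) = ((nrm A y)\<^sup>2) ^ (2 ^ j) \<and>
      (\<forall>v\<in>columns n k. nrm A (t j \<otimes> v) \<le> (K\<^sup>2) ^ (2 ^ j) * nrm A v)" for j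
  proof (induction j)
    case 0
    show ?case
      using base Y block_mult[OF block_adj[OF y] y] cstar_identity[OF Y(2)] by (auto simp: t0 adj_mult)
  next
    case (Suc j)
    then have tj: "t j \<in> block n k" "adj A (t j) = t j" "nrm A (t j) = ((nrm A y)\<^sup>2) ^ (2 ^ j)"
      "\<And>v. v \<in> columns n k \<Longrightarrow> nrm A (t j \<otimes> v) \<le> (K\<^sup>2) ^ (2 ^ j) * nrm A v" by auto
    note T = blockD(2)[OF tj(1)]
    have pow: "a ^ (2 ^ Suc j) = a ^ (2 ^ j) * a ^ (2 ^ j)" for a :: real
      by (simp flip: power_add) (simp add: mult_2)
    have "nrm A (t (Suc j)) = ((nrm A y)\<^sup>2) ^ (2 ^ Suc j)"
      using cstar_identity[OF T] tj by (simp only: tS pow) (simp add: power2_eq_square)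
    moreover have "nrm A (t (Suc j) \<otimes> v) \<le> (K\<^sup>2) ^ (2 ^ Suc j) * nrm A v" if v: "v \<in> columns n k" for v
    proof -
      have "nrm A (t (Suc j) \<otimes> v) = nrm A (t j \<otimes> (t j \<otimes> v))"
        using T columnsD(2)[OF v] by (simp add: tS m_assoc)
      also have "\<dots> \<le> (K\<^sup>2) ^ (2 ^ j) * nrm A (t j \<otimes> v)"
        using tj(4)[OF block_mult_columns[OF tj(1) v]] .
      also have "\<dots> \<le> (K\<^sup>2) ^ (2 ^ j) * ((K\<^sup>2) ^ (2 ^ j) * nrm A v)"
        using tj(4)[OF v] by (intro mult_left_mono) auto
      finally show ?thesis by (simp only: pow mult.assoc)
    qed
    ultimately show ?case using tj block_mult[OF tj(1) tj(1)] T by (simp add: tS adj_mult)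
  qed
  have "(nrm A y)\<^sup>2 \<le> K\<^sup>2"
  proof (rule le_of_power_two_pow_le)
    fix j
    have tj: "t j \<in> block n k" "nrm A (t j) = ((nrm A y)\<^sup>2) ^ (2 ^ j)"
      "\<And>v. v \<in> columns n k \<Longrightarrow> nrm A (t j \<otimes> v) \<le> (K\<^sup>2) ^ (2 ^ j) * nrm A v"
      using t[of j] by auto
    \<comment> \<open>\<open>t j\<close> absorbs \<open>Q (n - int k)\<close> on the right, so this
      crude bound is a bound for \<open>t j\<close> itself.\<close>
    have "nrm A (t j \<otimes> Q (n - int k)) \<le> 2 ^ k * (K\<^sup>2) ^ (2 ^ j)"
    proof (rule nrm_mult_Q_le)
      fix r assume r: "r \<in> frame n k"
      have "nrm A (t j \<otimes> r) \<le> (K\<^sup>2) ^ (2 ^ j) * nrm A r" using tj(3) frame_columns[OF r] .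
      also have "\<dots> \<le> (K\<^sup>2) ^ (2 ^ j) * 1" using nrm_frame_le[OF r] by (intro mult_left_mono) auto
      finally show "nrm A (t j \<otimes> r) \<le> (K\<^sup>2) ^ (2 ^ j)" by simp
    qed (use blockD(2)[OF tj(1)] in auto)
    then show "((nrm A y)\<^sup>2) ^ (2 ^ j) \<le> 2 ^ k * (K\<^sup>2) ^ (2 ^ j)"
      using blockD(4)[OF tj(1)] tj(2) by simp
  qed auto
  then show ?thesis using K by (rule power2_le_imp_le)
qed

section \<open>Closed ideals of the generated algebra\<close>

lemma closed_idealD:
  assumes J: "closed_ideal (A\<lparr>carrier := gen\<rparr>) J"
  shows "J \<subseteq> gen" "\<zero> \<in> J" "\<lbrakk>x \<in> J; y \<in> J\<rbrakk> \<Longrightarrow> x \<oplus> y \<in> J" "x \<in> J \<Longrightarrow> c \<odot> x \<in> J"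
    "\<lbrakk>a \<in> gen; x \<in> J\<rbrakk> \<Longrightarrow> a \<otimes> x \<in> J" "\<lbrakk>a \<in> gen; x \<in> J\<rbrakk> \<Longrightarrow> x \<otimes> a \<in> J"
    "\<lbrakk>\<And>m. f m \<in> J; x \<in> gen; (\<lambda>m. nrm A (f m \<ominus> x)) \<longlonglongrightarrow> 0\<rbrakk> \<Longrightarrow> x \<in> J"
proof -
  show "J \<subseteq> gen" "\<zero> \<in> J" "\<lbrakk>x \<in> J; y \<in> J\<rbrakk> \<Longrightarrow> x \<oplus> y \<in> J" "x \<in> J \<Longrightarrow> c \<odot> x \<in> J"
    "\<lbrakk>a \<in> gen; x \<in> J\<rbrakk> \<Longrightarrow> a \<otimes> x \<in> J" "\<lbrakk>a \<in> gen; x \<in> J\<rbrakk> \<Longrightarrow> x \<otimes> a \<in> J"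
    using J by (simp_all add: closed_ideal_def subspace_of_def)
  assume f: "\<And>m. f m \<in> J" "x \<in> gen" "(\<lambda>m. nrm A (f m \<ominus> x)) \<longlonglongrightarrow> 0"
  have "nrm_closed (A\<lparr>carrier := gen\<rparr>) J" using J by (simp add: closed_ideal_def)
  moreover have "(\<lambda>m. nrm (A\<lparr>carrier := gen\<rparr>) (f m \<ominus>\<^bsub>A\<lparr>carrier := gen\<rparr>\<^esub> x)) \<longlonglongrightarrow> 0"
    using f by (simp add: sub_minus[OF gen_subalgebra])
  ultimately show "x \<in> J"
    using f unfolding nrm_closed_def by (elim allE[of _ f] allE[of _ x]) simp
qed

text \<open>A Neumann series argument in the corner with unit \<open>Q n\<close>. With
  \<open>d\<close> the difference of \<open>Q n\<close> and \<open>z\<close>, the ideal contains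
  \<open>Q n\<close> minus each power of \<open>d\<close>, and these powers tend to zero.\<close>

lemma Q_mem_closed_ideal:
  assumes J: "closed_ideal (A\<lparr>carrier := gen\<rparr>) J"
    and z: "z \<in> J" "Q n \<otimes> z = z" "z \<otimes> Q n = z" and lt: "nrm A (Q n \<ominus> z) < 1"
  shows "Q n \<in> J"
proof -
  note J' = closed_idealD[OF J]
  define d where "d = Q n \<ominus> z"
  have zg: "z \<in> gen" using z J' by auto
  have d: "d \<in> gen" by (simp add: d_def zg gen_closed Q_gen)
  \<comment> \<open>\<open>p m\<close> is \<open>d\<close> to the power \<open>Suc m\<close>;
    starting at \<open>d\<close> makes the induction begin with \<open>Q n\<close> minus
    \<open>d\<close>, which is \<open>z\<close>.\<close>
  define p where "p = rec_nat d (\<lambda>_ x. x \<otimes> d)"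
  have p0: "p 0 = d" and pS: "p (Suc m) = p m \<otimes> d" for m by (simp_all add: p_def)
  have pg: "p m \<in> gen" for m by (induction m) (simp_all add: p0 pS d gen_closed)
  have dQ: "d \<otimes> Q n = d" using zg z by (simp add: d_def l_distrib_minus Q_Q)
  have pQ: "p m \<otimes> Q n = p m" for m
    by (cases m) (use pg d dQ in \<open>simp_all add: p0 pS m_assoc\<close>)
  have q: "Q n \<ominus> p m \<in> J" for m
  proof (induction m)
    case 0
    have "Q n \<ominus> d = z" using zg by (simp add: d_def minus_eq_scale scale_add_right scale_one a_assoc[symmetric] flip: scale_scale)
       (simp flip: a_inv_eq_scale add: r_neg)
    then show ?case using z by (simp add: p0)
  next
    case (Suc m)
    have "p (Suc m) = p m \<ominus> p m \<otimes> z"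
      using pg zg by (simp add: pS d_def r_distrib_minus pQ)
    then have "Q n \<ominus> p (Suc m) = (Q n \<ominus> p m) \<oplus> p m \<otimes> z"
      using pg[of m] zg by (simp add: a_minus_def minus_add a_assoc)
    then show ?case using Suc J'(3) J'(5)[OF pg z(1)] by simp
  qed
  have np: "nrm A (p m) \<le> nrm A d ^ Suc m" for m
  proof (induction m)
    case (Suc m)
    have "nrm A (p (Suc m)) \<le> nrm A (p m) * nrm A d" using pg d by (simp add: pS nrm_mult)
    also have "\<dots> \<le> nrm A d ^ Suc m * nrm A d" using Suc d nrm_nonneg by (intro mult_right_mono) auto
    finally show ?case by (simp add: mult.commute)
  qed (simp add: p0)
  have "(\<lambda>m. nrm A ((Q n \<ominus> p m) \<ominus> Q n)) \<longlonglongrightarrow> 0"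
  proof (rule real_tendsto_sandwich[OF _ _ tendsto_const])
    have "(Q n \<ominus> p m) \<ominus> Q n = (-1) \<odot> p m" for m
      using pg[of m] by (simp add: a_minus_def a_assoc a_lcomm[of "Q n"] r_neg flip: a_inv_eq_scale)
    then have eq: "nrm A ((Q n \<ominus> p m) \<ominus> Q n) = nrm A (p m)" for m
      using pg[of m] by (simp add: nrm_scale)
    show "\<forall>\<^sub>F m in sequentially. 0 \<le> nrm A ((Q n \<ominus> p m) \<ominus> Q n)"
      by (simp add: eq nrm_nonneg pg)
    show "\<forall>\<^sub>F m in sequentially. nrm A ((Q n \<ominus> p m) \<ominus> Q n) \<le> nrm A d ^ Suc m"
      using np by (simp only: eq) simp
    show "(\<lambda>m. nrm A d ^ Suc m) \<longlonglongrightarrow> 0"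
      using lt d nrm_nonneg by (intro LIMSEQ_Suc LIMSEQ_power_zero) (simp add: d_def zg)
  qed
  then show ?thesis by (rule J'(7)[OF q Q_gen])
qed

lemma closed_ideal_has_Q:
  assumes J: "closed_ideal (A\<lparr>carrier := gen\<rparr>) J" and x: "x \<in> J" "x \<noteq> \<zero>"
  shows "\<exists>n. Q n \<in> J"
proof -
  note J' = closed_idealD[OF J]
  have xg: "x \<in> gen" using x J' by auto
  then have xc: "x \<in> carrier A" by simp
  have nx: "nrm A x > 0" using nrm_eq_zero[OF xc] nrm_nonneg[OF xc] x by simp
  \<comment> \<open>A quarter keeps \<open>nrm A y\<close> above, and the distance from
    \<open>x\<close> to \<open>y\<close> below, the same half of \<open>nrm A x\<close>; the two
    estimates meet in the final strict bound by 1.\<close>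
  then obtain y where "y \<in> blocks" and xy: "nrm A (x \<ominus> y) < nrm A x / 4"
    using nrm_closureD[of x blocks "nrm A x / 4"] gen_subset_closure xg by auto
  then obtain n k where y: "y \<in> block n k" by (auto simp: blocks_def)
  note Y = blockD[OF y]
  have ny: "nrm A y > nrm A x / 2" using nrm_le_nrm_minus[OF xc Y(2)] xy nx by simp
  \<comment> \<open>The contrapositive of \<open>nrm_block_le\<close> with constant
    \<open>nrm A x / 2\<close> supplies the column.\<close>
  have "\<exists>v\<in>columns n k. nrm A x / 2 * nrm A v < nrm A (y \<otimes> v)"
    using nrm_block_le[OF y, of "nrm A x / 2"] ny nx by force
  then obtain v where v: "v \<in> columns n k" and yv: "nrm A x / 2 * nrm A v < nrm A (y \<otimes> v)" by blast
  define w where "w = y \<otimes> v"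
  have w: "w \<in> columns n k" using block_mult_columns[OF y v] by (simp add: w_def)
  note W = columnsD[OF w] and V = columnsD[OF v]
  have nw: "nrm A w > 0"
    using yv nx nrm_nonneg[OF V(2)] by (simp add: w_def) (smt (verit) mult_nonneg_nonneg)
  obtain c where c: "adj A w \<otimes> w = c \<odot> Q n" using columns_inner[OF w w] corner_iff by blast
  have ww: "(nrm A w)\<^sup>2 = cmod c * nrm A (Q n)" using cstar_identity[OF W(2)] by (simp add: c nrm_scale)
  have "Q n \<noteq> \<zero>" "c \<noteq> 0" using ww nw by auto
  then have "nrm A (Q n) = 1" by (intro nrm_projection_eq_one) (simp_all add: Q_Q)
  then have cw: "cmod c = (nrm A w)\<^sup>2" using ww by simp
  \<comment> \<open>With \<open>y\<close> in place of \<open>x\<close> this expression would be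
    exactly \<open>Q n\<close>, because \<open>w\<close> is \<open>y\<close> times \<open>v\<close>.
    So the distance from \<open>z\<close> to \<open>Q n\<close> is controlled by that from
    \<open>x\<close> to \<open>y\<close>.\<close>
  define z where "z = inverse c \<odot> (adj A w \<otimes> (x \<otimes> v))"
  have z: "z \<in> J" unfolding z_def using x W V by (intro J'(4) J'(5) J'(6) gen_closed)
  have Qw: "Q n \<otimes> adj A w = adj A w" using arg_cong[OF W(4), of "adj A"] W(2) by (simp add: adj_mult)
  have zQ: "Q n \<otimes> z = z" "z \<otimes> Q n = z"
    using Qw xc W(2) V(2,4) by (simp_all add: z_def scale_mult_left scale_mult_right m_assoc) (simp flip: m_assoc)
  have Qe: "Q n = inverse c \<odot> (adj A w \<otimes> (y \<otimes> v))"
    using \<open>c \<noteq> 0\<close> by (simp add: c scale_one flip: w_def scale_scale)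
  have "Q n \<ominus> z = inverse c \<odot> (adj A w \<otimes> ((y \<ominus> x) \<otimes> v))"
    using xc Y(2) W(2) V(2) by (subst Qe) (simp add: z_def scale_minus r_distrib_minus l_distrib_minus)
  then have "nrm A (Q n \<ominus> z) = nrm A (adj A w \<otimes> ((y \<ominus> x) \<otimes> v)) / (nrm A w)\<^sup>2"
    using xc Y(2) W(2) V(2) by (simp add: nrm_scale norm_inverse cw divide_inverse mult.commute)
  also have "\<dots> \<le> (nrm A w * (nrm A (y \<ominus> x) * nrm A v)) / (nrm A w)\<^sup>2"
  proof (rule divide_right_mono)
    have "nrm A (adj A w \<otimes> ((y \<ominus> x) \<otimes> v)) \<le> nrm A (adj A w) * nrm A ((y \<ominus> x) \<otimes> v)"
      using xc Y(2) W(2) V(2) by (intro nrm_mult) auto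
    also have "\<dots> \<le> nrm A w * (nrm A (y \<ominus> x) * nrm A v)"
      using xc Y(2) W(2) V(2) by (simp add: nrm_mult mult_left_mono nrm_nonneg)
    finally show "nrm A (adj A w \<otimes> ((y \<ominus> x) \<otimes> v)) \<le> nrm A w * (nrm A (y \<ominus> x) * nrm A v)" .
  qed simp
  also have "\<dots> = nrm A (y \<ominus> x) * nrm A v / nrm A w" using nw by (simp add: power2_eq_square)
  also have "\<dots> < 1"
  proof -
    have "nrm A (y \<ominus> x) * nrm A v \<le> nrm A x / 2 * nrm A v"
      using xy nx nrm_minus_commute[OF xc Y(2)] nrm_nonneg[OF V(2)] by (intro mult_right_mono) auto
    then show ?thesis using yv nw by (simp add: w_def)
  qed
  finally show ?thesis using Q_mem_closed_ideal[OF J z zQ] by blast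
qed

lemma closed_ideal_eq_gen:
  assumes J: "closed_ideal (A\<lparr>carrier := gen\<rparr>) J" and x: "x \<in> J" "x \<noteq> \<zero>"
  shows "J = gen"
proof
  note J' = closed_idealD[OF J]
  show "J \<subseteq> gen" by (rule J'(1))
  obtain n where n: "Q n \<in> J" using closed_ideal_has_Q[OF assms] by blast
  \<comment> \<open>Downwards, \<open>Q_pred\<close> writes the next projection as a sum of
    \<open>Q ?i\<close> and a conjugate of it, both in the ideal.\<close>
  have down: "Q (n - int k) \<in> J" for k
  proof (induction k)
    case (Suc k)
    let ?i = "n - int k"
    have "Q (?i - 1) \<in> J"
      unfolding Q_pred by (intro J'(3) J'(5) J'(6) Suc gen_closed b_gen)
    moreover have "n - int (Suc k) = ?i - 1" by simp
    ultimately show ?case by (simp only:)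
  qed (simp add: n)
  have Q: "Q m \<in> J" for m
  proof (cases "m \<le> n")
    case True
    then show ?thesis using down[of "nat (n - m)"] by simp
  next
    case False
    \<comment> \<open>Upwards, \<open>Q m\<close> lies under \<open>Q n\<close> and is absorbed by
      it.\<close>
    then have "Q m = Q n \<otimes> Q m" by (simp add: Q_Q)
    then show ?thesis using J'(6)[OF Q_gen n] by metis
  qed
  have "blocks \<subseteq> J"
  proof
    fix y assume "y \<in> blocks"
    then obtain n k where "y \<in> block n k" by (auto simp: blocks_def)
    then show "y \<in> J" using J'(6)[OF _ Q, of y "n - int k"] blockD by metis
  qed
  show "gen \<subseteq> J"
  proof
    fix y assume y: "y \<in> gen"
    then have "y \<in> carrier A" by simp
    have "\<exists>a\<in>J. nrm A (a \<ominus> y) < inverse (real (Suc m))" for m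
    proof -
      obtain a where "a \<in> blocks" "nrm A (y \<ominus> a) < inverse (real (Suc m))"
        using nrm_closureD[of y blocks "inverse (real (Suc m))"] gen_subset_closure y by auto
      then show ?thesis using \<open>blocks \<subseteq> J\<close> blocks_gen nrm_minus_commute[OF \<open>y \<in> carrier A\<close>, of a]
        by (metis gen_carrier subsetD)
    qed
    then obtain f where f: "\<And>m. f m \<in> J" "\<And>m. nrm A (f m \<ominus> y) < inverse (real (Suc m))" by metis
    have "(\<lambda>m. nrm A (f m \<ominus> y)) \<longlonglongrightarrow> 0"
    proof (rule real_tendsto_sandwich[OF _ _ tendsto_const LIMSEQ_inverse_real_of_nat])
      have "f m \<ominus> y \<in> carrier A" for m using f(1)[of m] J'(1) y by (intro minus_closed) auto
      then show "\<forall>\<^sub>F m in sequentially. 0 \<le> nrm A (f m \<ominus> y)"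
        by (intro always_eventually allI nrm_nonneg)
      show "\<forall>\<^sub>F m in sequentially. nrm A (f m \<ominus> y) \<le> inverse (real (Suc m))"
        using f(2) by (intro always_eventually allI less_imp_le)
    qed
    then show "y \<in> J" by (rule J'(7)[OF f(1) y])
  qed
qed

theorem simple_gen:
  assumes "b i \<noteq> \<zero>"
  shows "simple_cstar_algebra (A\<lparr>carrier := gen\<rparr>)"
proof -
  have "J = {\<zero>} \<or> J = gen" if J: "closed_ideal (A\<lparr>carrier := gen\<rparr>) J" for J
    using closed_ideal_eq_gen[OF J] closed_idealD(2)[OF J] by blast
  moreover have "gen \<noteq> {\<zero>}" using assms b_gen by blast
  ultimately show ?thesis
    using sub_cstar_algebra[OF gen_subalgebra] by (simp add: simple_cstar_algebra_def)
qed

end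

section \<open>The Hilbert space of square-summable functions\<close>

definition sq_summable :: "('i \<Rightarrow> complex) \<Rightarrow> bool" where
  "sq_summable f \<longleftrightarrow> (\<lambda>i. (cmod (f i))\<^sup>2) summable_on UNIV"

lemma sq_summableI:
  assumes "\<And>F. finite F \<Longrightarrow> (\<Sum>i\<in>F. (cmod (f i))\<^sup>2) \<le> C"
  shows "sq_summable f"
  unfolding sq_summable_def using assms
  by (intro nonneg_bdd_above_summable_on bdd_aboveI[of _ C]) auto

lemma sq_summable_add:
  assumes "sq_summable f" "sq_summable g"
  shows "sq_summable (\<lambda>i. f i + g i)"
proof -
  have "(\<lambda>i. 2 * (cmod (f i))\<^sup>2 + 2 * (cmod (g i))\<^sup>2) summable_on UNIV"
    using assms unfolding sq_summable_def by (intro summable_on_add summable_on_cmult_right)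
  moreover have "(cmod (f i + g i))\<^sup>2 \<le> 2 * (cmod (f i))\<^sup>2 + 2 * (cmod (g i))\<^sup>2" for i
  proof -
    have "(cmod (f i + g i))\<^sup>2 \<le> (cmod (f i) + cmod (g i))\<^sup>2"
      by (intro power_mono norm_triangle_ineq) auto
    also have "\<dots> \<le> 2 * (cmod (f i))\<^sup>2 + 2 * (cmod (g i))\<^sup>2"
      using sum_squares_bound[of "cmod (f i)" "cmod (g i)"] by (simp add: power2_sum)
    finally show ?thesis .
  qed
  ultimately show ?thesis
    unfolding sq_summable_def by (rule summable_on_comparison_test) auto
qed

lemma sq_summable_cmult: "sq_summable f \<Longrightarrow> sq_summable (\<lambda>i. c * f i)"
  unfolding sq_summable_def by (simp add: norm_mult power_mult_distrib summable_on_cmult_right)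

lemma sq_summable_inner:
  assumes "sq_summable f" "sq_summable g"
  shows "(\<lambda>i. f i \<bullet> g i) summable_on UNIV"
proof -
  have "(\<lambda>i. (cmod (f i))\<^sup>2 + (cmod (g i))\<^sup>2) summable_on UNIV"
    using assms unfolding sq_summable_def by (intro summable_on_add)
  then have "(\<lambda>i. \<bar>f i \<bullet> g i\<bar>) summable_on UNIV"
  proof (rule summable_on_comparison_test)
    fix i
    have "\<bar>f i \<bullet> g i\<bar> \<le> cmod (f i) * cmod (g i)" by (rule Cauchy_Schwarz_ineq2)
    also have "\<dots> \<le> (cmod (f i))\<^sup>2 + (cmod (g i))\<^sup>2"
      using sum_squares_bound[of "cmod (f i)" "cmod (g i)"]
        mult_nonneg_nonneg[OF norm_ge_zero norm_ge_zero, of "f i" "g i"] by linarith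
    finally show "\<bar>f i \<bullet> g i\<bar> \<le> (cmod (f i))\<^sup>2 + (cmod (g i))\<^sup>2" .
  qed auto
  then show ?thesis using summable_on_iff_abs_summable_on_real[of "\<lambda>i. f i \<bullet> g i" UNIV] by simp
qed

typedef 'i ell2 = "{f :: 'i \<Rightarrow> complex. sq_summable f}"
  morphisms coord Abs_ell2
  by (rule exI[of _ "\<lambda>_. 0"]) (simp add: sq_summable_def)

setup_lifting type_definition_ell2

lemma sq_summable_coord [simp]: "sq_summable (coord x)"
  using coord[of x] by simp

lemma ell2_eqI: "(\<And>i. coord x i = coord y i) \<Longrightarrow> x = y"
  by (metis coord_inject ext)

text \<open>The inner product is the real part of the Hermitian form, which brings the real type
  classes and bounded linear maps into play; the complex structure is carried separately by
  \<open>imult\<close>.\<close>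

instantiation ell2 :: (type) real_inner
begin

lift_definition zero_ell2 :: "'a ell2" is "\<lambda>_. 0"
  by (simp add: sq_summable_def)

lift_definition plus_ell2 :: "'a ell2 \<Rightarrow> 'a ell2 \<Rightarrow> 'a ell2" is "\<lambda>f g i. f i + g i"
  by (rule sq_summable_add)

lift_definition uminus_ell2 :: "'a ell2 \<Rightarrow> 'a ell2" is "\<lambda>f i. - f i"
  by (simp add: sq_summable_def)

lift_definition minus_ell2 :: "'a ell2 \<Rightarrow> 'a ell2 \<Rightarrow> 'a ell2" is "\<lambda>f g i. f i - g i"
  using sq_summable_add[of _ "\<lambda>i. - _ i"] by (simp add: sq_summable_def)

lift_definition scaleR_ell2 :: "real \<Rightarrow> 'a ell2 \<Rightarrow> 'a ell2" is "\<lambda>c f i. c *\<^sub>R f i"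
  by (simp add: sq_summable_cmult scaleR_conv_of_real)

definition inner_ell2 :: "'a ell2 \<Rightarrow> 'a ell2 \<Rightarrow> real" where
  "inner_ell2 x y = (\<Sum>\<^sub>\<infinity>i. coord x i \<bullet> coord y i)"

definition norm_ell2 :: "'a ell2 \<Rightarrow> real" where "norm_ell2 x = sqrt (x \<bullet> x)"

definition dist_ell2 :: "'a ell2 \<Rightarrow> 'a ell2 \<Rightarrow> real" where "dist_ell2 x y = norm (x - y)"

definition sgn_ell2 :: "'a ell2 \<Rightarrow> 'a ell2" where "sgn_ell2 x = inverse (norm x) *\<^sub>R x"

definition uniformity_ell2 :: "('a ell2 \<times> 'a ell2) filter" where
  "uniformity_ell2 = (INF e\<in>{0<..}. principal {(x, y). dist x y < e})"

definition open_ell2 :: "'a ell2 set \<Rightarrow> bool" where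
  "open_ell2 U \<longleftrightarrow> (\<forall>x\<in>U. eventually (\<lambda>(x', y). x' = x \<longrightarrow> y \<in> U) uniformity)"

instance
proof
  fix x y z :: "'a ell2" and c d :: real
  show "x + y + z = x + (y + z)" "x + y = y + x" "0 + x = x" "- x + x = 0" "x - y = x + - y"
    by (transfer, simp add: algebra_simps)+
  show "c *\<^sub>R (x + y) = c *\<^sub>R x + c *\<^sub>R y" "(c + d) *\<^sub>R x = c *\<^sub>R x + d *\<^sub>R x"
    "c *\<^sub>R d *\<^sub>R x = (c * d) *\<^sub>R x" "1 *\<^sub>R x = x"
    by (transfer, simp add: algebra_simps)+
  show "dist x y = norm (x - y)" by (rule dist_ell2_def)
  show "sgn x = inverse (norm x) *\<^sub>R x" by (rule sgn_ell2_def)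
  show "uniformity = (INF e\<in>{0<..}. principal {(x :: 'a ell2, y). dist x y < e})"
    by (rule uniformity_ell2_def)
  show "open U \<longleftrightarrow> (\<forall>x\<in>U. \<forall>\<^sub>F (x', y) in uniformity. x' = x \<longrightarrow> y \<in> U)" for U :: "'a ell2 set"
    by (rule open_ell2_def)
  show "x \<bullet> y = y \<bullet> x" by (simp add: inner_ell2_def inner_commute)
  show "(x + y) \<bullet> z = x \<bullet> z + y \<bullet> z"
    unfolding inner_ell2_def plus_ell2.rep_eq inner_add_left
    by (intro infsum_add sq_summable_inner sq_summable_coord)
  show "(c *\<^sub>R x) \<bullet> y = c * (x \<bullet> y)"
    by (simp add: inner_ell2_def scaleR_ell2.rep_eq infsum_cmult_right')
  show nn: "0 \<le> x \<bullet> x" by (simp add: inner_ell2_def infsum_nonneg)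
  show "x \<bullet> x = 0 \<longleftrightarrow> x = 0"
  proof
    assume "x \<bullet> x = 0"
    then have "coord x i \<bullet> coord x i = 0" for i
      using nonneg_infsum_le_0D[of "\<lambda>i. coord x i \<bullet> coord x i" UNIV i]
      by (simp add: inner_ell2_def sq_summable_inner)
    then show "x = 0" by (intro ell2_eqI) (simp add: zero_ell2.rep_eq)
  qed (simp add: inner_ell2_def zero_ell2.rep_eq)
  show "norm x = sqrt (x \<bullet> x)" by (rule norm_ell2_def)
qed

end

lemmas coord_simps [simp] =
  zero_ell2.rep_eq plus_ell2.rep_eq uminus_ell2.rep_eq minus_ell2.rep_eq scaleR_ell2.rep_eq

lemma coord_sum [simp]: "coord (\<Sum>k\<in>F. f k) i = (\<Sum>k\<in>F. coord (f k) i)"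
  by (induction F rule: infinite_finite_induct) auto

lemma norm_ell2_sq: "(norm x)\<^sup>2 = (\<Sum>\<^sub>\<infinity>i. (cmod (coord x i))\<^sup>2)"
  by (simp add: power2_norm_eq_inner inner_ell2_def)

lemma sum_coord_le_norm: "finite F \<Longrightarrow> (\<Sum>i\<in>F. (cmod (coord x i))\<^sup>2) \<le> (norm x)\<^sup>2"
  unfolding norm_ell2_sq
  using sq_summable_coord[of x] by (intro finite_sum_le_infsum) (auto simp: sq_summable_def)

lemma norm_ell2_leI:
  assumes "0 \<le> C" "\<And>F. finite F \<Longrightarrow> (\<Sum>i\<in>F. (cmod (coord x i))\<^sup>2) \<le> C\<^sup>2"
  shows "norm x \<le> C"
proof -
  have "(norm x)\<^sup>2 \<le> C\<^sup>2"
    unfolding norm_ell2_sq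
    using sq_summable_coord[of x] assms by (intro infsum_le_finite_sums) (auto simp: sq_summable_def)
  then show ?thesis using assms(1) by (rule power2_le_imp_le)
qed

lemma norm_coord_le: "cmod (coord x i) \<le> norm x"
  by (rule power2_le_imp_le) (use sum_coord_le_norm[of "{i}" x] in simp_all)

text \<open>Each coordinate is dominated by the norm and so converges. The Cauchy estimate on finite
  partial sums survives the limit in one index, which yields both square-summability of the limit
  and convergence in norm.\<close>

instance ell2 :: (type) complete_space
proof
  fix X :: "nat \<Rightarrow> 'a ell2" assume X: "Cauchy X"
  have "Cauchy (\<lambda>n. coord (X n) i)" for i
  proof (rule metric_CauchyI)
    fix e :: real assume "e > 0"
    then obtain N where N: "\<And>m n. m \<ge> N \<Longrightarrow> n \<ge> N \<Longrightarrow> dist (X m) (X n) < e"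
      using X by (meson metric_CauchyD)
    have "dist (coord (X m) i) (coord (X n) i) \<le> dist (X m) (X n)" for m n
      using norm_coord_le[of "X m - X n" i] by (simp add: dist_norm)
    then show "\<exists>N. \<forall>m\<ge>N. \<forall>n\<ge>N. dist (coord (X m) i) (coord (X n) i) < e"
      using N by (meson le_less_trans)
  qed
  then have "\<exists>l. (\<lambda>n. coord (X n) i) \<longlonglongrightarrow> l" for i
    by (simp add: Cauchy_convergent_iff convergent_def)
  then obtain L where L: "\<And>i. (\<lambda>n. coord (X n) i) \<longlonglongrightarrow> L i" by metis
  have tail: "\<exists>N. \<forall>n\<ge>N. \<forall>F. finite F \<longrightarrow> (\<Sum>i\<in>F. (cmod (coord (X n) i - L i))\<^sup>2) \<le> e\<^sup>2"
    if "e > 0" for e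
  proof -
    obtain N where N: "\<And>m n. m \<ge> N \<Longrightarrow> n \<ge> N \<Longrightarrow> dist (X m) (X n) < e"
      using X \<open>e > 0\<close> by (meson metric_CauchyD)
    have "(\<Sum>i\<in>F. (cmod (coord (X n) i - L i))\<^sup>2) \<le> e\<^sup>2" if n: "n \<ge> N" and F: "finite F" for n F
    proof (rule tendsto_upperbound)
      show "(\<lambda>m. \<Sum>i\<in>F. (cmod (coord (X n) i - coord (X m) i))\<^sup>2)
          \<longlonglongrightarrow> (\<Sum>i\<in>F. (cmod (coord (X n) i - L i))\<^sup>2)"
        by (intro tendsto_intros L)
      have "(\<Sum>i\<in>F. (cmod (coord (X n) i - coord (X m) i))\<^sup>2) \<le> e\<^sup>2" if m: "m \<ge> N" for m
      proof -
        have "(\<Sum>i\<in>F. (cmod (coord (X n - X m) i))\<^sup>2) \<le> (norm (X n - X m))\<^sup>2"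
          by (rule sum_coord_le_norm[OF F])
        also have "\<dots> \<le> e\<^sup>2" using N[OF n m] by (intro power_mono) (auto simp: dist_norm)
        finally show ?thesis by simp
      qed
      then show "\<forall>\<^sub>F m in sequentially. (\<Sum>i\<in>F. (cmod (coord (X n) i - coord (X m) i))\<^sup>2) \<le> e\<^sup>2"
        by (auto simp: eventually_sequentially)
    qed simp
    then show ?thesis by blast
  qed
  obtain N where N: "\<And>n F. n \<ge> N \<Longrightarrow> finite F \<Longrightarrow> (\<Sum>i\<in>F. (cmod (coord (X n) i - L i))\<^sup>2) \<le> 1\<^sup>2"
    using tail[of 1] by auto
  have "sq_summable (\<lambda>i. coord (X N) i - L i)"
    using N[of N] by (intro sq_summableI) auto
  then have "sq_summable (\<lambda>i. (-1) * (coord (X N) i - L i))" by (rule sq_summable_cmult)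
  from sq_summable_add[OF this sq_summable_coord[of "X N"]] have "sq_summable L" by simp
  then obtain l where l: "coord l = L" using Abs_ell2_inverse by blast
  have "X \<longlonglongrightarrow> l"
  proof (rule metric_LIMSEQ_I)
    fix e :: real assume "e > 0"
    then obtain N where N: "\<forall>n\<ge>N. \<forall>F. finite F \<longrightarrow> (\<Sum>i\<in>F. (cmod (coord (X n) i - L i))\<^sup>2) \<le> (e/2)\<^sup>2"
      using tail[of "e/2"] by auto
    then have "dist (X n) l \<le> e / 2" if "n \<ge> N" for n
      unfolding dist_norm using that \<open>e > 0\<close> by (intro norm_ell2_leI) (auto simp: l)
    then show "\<exists>N. \<forall>n\<ge>N. dist (X n) l < e"
      using \<open>e > 0\<close> by (intro exI[of _ N]) (force intro: le_less_trans)
  qed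
  then show "convergent X" by (auto simp: convergent_def)
qed

instance ell2 :: (type) banach ..

section \<open>Basis vectors and multiplication by the imaginary unit\<close>

lift_definition ell2_unit :: "'i \<Rightarrow> 'i ell2" is "\<lambda>i j. if j = i then 1 else 0"
proof -
  fix i :: 'i
  have "(\<lambda>j. (cmod (if j = i then 1 else 0))\<^sup>2) summable_on {i}" by simp
  then show "sq_summable (\<lambda>j. if j = i then 1 else 0)"
    unfolding sq_summable_def by (rule summable_on_cong_neutral[THEN iffD1, rotated -1]) auto
qed

lift_definition imult :: "'i ell2 \<Rightarrow> 'i ell2" is "\<lambda>f i. \<i> * f i"
  by (rule sq_summable_cmult)

lemmas [simp] = ell2_unit.rep_eq imult.rep_eq

lemma inner_ell2_unit: "x \<bullet> ell2_unit i = Re (coord x i)"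
proof -
  have "x \<bullet> ell2_unit i = (\<Sum>\<^sub>\<infinity>j\<in>{i}. coord x j \<bullet> coord (ell2_unit i) j)"
    unfolding inner_ell2_def by (rule infsum_cong_neutral) auto
  then show ?thesis by (simp add: inner_complex_def)
qed

lemma imult_imult [simp]: "imult (imult x) = - x"
  by (rule ell2_eqI) simp

lemma inner_imult: "imult x \<bullet> y = - (x \<bullet> imult y)"
  by (simp add: inner_ell2_def inner_complex_def infsum_uminus[symmetric] algebra_simps)

lemma imult_linear [simp]:
  "imult (x + y) = imult x + imult y" "imult (c *\<^sub>R x) = c *\<^sub>R imult x" "imult (- x) = - imult x"
  "imult (x - y) = imult x - imult y"
  by (auto intro!: ell2_eqI simp: algebra_simps)

lemma norm_imult [simp]: "norm (imult x) = norm x"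
  by (simp add: norm_eq_sqrt_inner inner_imult)

lemma bounded_linear_imult: "bounded_linear imult"
  by (rule bounded_linear_intro[where K = 1]) auto

text \<open>The inner product is real, so the imaginary part of a coordinate is obtained by pairing
  with \<open>imult (ell2_unit i)\<close>.\<close>

lemma coord_eq_inner: "coord x i = Complex (x \<bullet> ell2_unit i) (x \<bullet> imult (ell2_unit i))"
  using inner_ell2_unit[of "imult x" i] unfolding inner_imult
  by (simp add: inner_ell2_unit complex_eq_iff)

section \<open>The C*-algebra of adjointable operators\<close>

type_synonym 'i ell2_map = "'i ell2 \<Rightarrow>\<^sub>L 'i ell2"

definition adjoint_pair :: "'i ell2_map \<Rightarrow> 'i ell2_map \<Rightarrow> bool" where
  "adjoint_pair T S \<longleftrightarrow> (\<forall>x y. blinfun_apply T x \<bullet> y = x \<bullet> blinfun_apply S y)"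

text \<open>Commuting with \<open>imult\<close> expresses complex linearity of a real-linear map.
  Existence of an adjoint is built into the carrier, so that completeness has to produce an adjoint
  for a limit.\<close>

definition ops :: "'i ell2_map set" where
  "ops = {T. (\<forall>x. blinfun_apply T (imult x) = imult (T x)) \<and> (\<exists>S. adjoint_pair T S)}"

definition star :: "'i ell2_map \<Rightarrow> 'i ell2_map" where
  "star T = (SOME S. adjoint_pair T S)"

definition iop :: "'i ell2_map" where "iop = Blinfun imult"

text \<open>Bounded linear maps carry real scalars here; multiplication by the imaginary unit is
  composition with \<open>iop\<close>.\<close>

definition cscale :: "complex \<Rightarrow> 'i ell2_map \<Rightarrow> 'i ell2_map" where
  "cscale c T = Re c *\<^sub>R T + Im c *\<^sub>R (iop o\<^sub>L T)"

lemma iop_apply [simp]: "blinfun_apply iop x = imult x"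
  by (simp add: iop_def bounded_linear_Blinfun_apply bounded_linear_imult)

lemma cscale_apply:
  "blinfun_apply (cscale c T) x = Re c *\<^sub>R blinfun_apply T x + Im c *\<^sub>R imult (blinfun_apply T x)"
  by (simp add: cscale_def blinfun.add_left blinfun.scaleR_left)

lemma coord_cscale [simp]: "coord (blinfun_apply (cscale c T) x) i = c * coord (blinfun_apply T x) i"
  by (simp add: cscale_apply complex_eq_iff)

lemma adjoint_pair_unique:
  assumes "adjoint_pair T S" "adjoint_pair T S'"
  shows "S = S'"
proof (rule blinfun_eqI)
  fix y
  have "x \<bullet> S y = x \<bullet> S' y" for x using assms by (metis adjoint_pair_def)
  then show "S y = S' y" using vector_eq_rdot[of "S y" "S' y"] by (metis inner_commute)
qed

lemma adjoint_pair_sym: "adjoint_pair T S \<Longrightarrow> adjoint_pair S T"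
  by (metis adjoint_pair_def inner_commute)

lemma ops_imult: "T \<in> ops \<Longrightarrow> blinfun_apply T (imult x) = imult (blinfun_apply T x)"
  by (simp add: ops_def)

lemma adjoint_pair_star: "T \<in> ops \<Longrightarrow> adjoint_pair T (star T)"
  unfolding star_def ops_def by (auto intro: someI_ex)

lemma star_eqI: "adjoint_pair T S \<Longrightarrow> star T = S"
  unfolding star_def by (metis adjoint_pair_unique someI_ex)

lemma star_inner: "T \<in> ops \<Longrightarrow> blinfun_apply T x \<bullet> y = x \<bullet> star T y"
  using adjoint_pair_star[of T] by (simp add: adjoint_pair_def)

text \<open>\<open>imult\<close> is skew-adjoint, so moving it across the inner product and back
  costs two signs that cancel. The real adjoint of a complex-linear operator is therefore
  complex-linear.\<close>

lemma star_ops [simp]: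
  assumes T: "T \<in> ops"
  shows "star T \<in> ops"
proof -
  have "star T (imult y) = imult (star T y)" for y
  proof -
    have "star T (imult y) \<bullet> x = imult (star T y) \<bullet> x" for x
    proof -
      have "star T (imult y) \<bullet> x = T x \<bullet> imult y" using T by (metis star_inner inner_commute)
      also have "\<dots> = - (imult (T x) \<bullet> y)" by (simp add: inner_imult)
      also have "\<dots> = - (T (imult x) \<bullet> y)" using T by (simp add: ops_imult)
      also have "\<dots> = - (imult x \<bullet> star T y)" using T by (simp add: star_inner)
      also have "\<dots> = imult (star T y) \<bullet> x" by (simp add: inner_imult inner_commute)
      finally show ?thesis .
    qed
    then show ?thesis using vector_eq_rdot by blast
  qed
  then show ?thesis
    using adjoint_pair_sym[OF adjoint_pair_star[OF T]] unfolding ops_def by blast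
qed

lemma star_star [simp]: "T \<in> ops \<Longrightarrow> star (star T) = T"
  by (rule star_eqI[OF adjoint_pair_sym[OF adjoint_pair_star]])

lemma opsI: "\<lbrakk>\<And>x. blinfun_apply T (imult x) = imult (blinfun_apply T x); adjoint_pair T S\<rbrakk> \<Longrightarrow> T \<in> ops"
  by (auto simp: ops_def)

lemma adjoint_pair_add:
  "\<lbrakk>adjoint_pair T T'; adjoint_pair S S'\<rbrakk> \<Longrightarrow> adjoint_pair (T + S) (T' + S')"
  by (simp add: adjoint_pair_def blinfun.add_left inner_add_left inner_add_right)

lemma adjoint_pair_compose:
  "\<lbrakk>adjoint_pair T T'; adjoint_pair S S'\<rbrakk> \<Longrightarrow> adjoint_pair (T o\<^sub>L S) (S' o\<^sub>L T')"
  by (simp add: adjoint_pair_def)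

lemma adjoint_pair_cscale:
  assumes "T \<in> ops"
  shows "adjoint_pair (cscale c T) (cscale (cnj c) (star T))"
  unfolding adjoint_pair_def
proof (intro allI)
  fix x y
  have "imult (T x) \<bullet> y = - (x \<bullet> imult (star T y))"
    using assms star_inner[OF assms, of x "imult y"] by (simp add: inner_imult ops_imult)
  then show "cscale c T x \<bullet> y = x \<bullet> cscale (cnj c) (star T) y"
    using assms by (simp add: cscale_apply inner_add_left inner_add_right star_inner inner_diff_right)
qed

lemma adjoint_pair_zero: "adjoint_pair 0 0"
  by (simp add: adjoint_pair_def)

lemma adjoint_pair_id: "adjoint_pair id_blinfun id_blinfun"
  by (simp add: adjoint_pair_def)

lemma ops_zero [simp]: "0 \<in> ops"
  by (rule opsI[OF _ adjoint_pair_zero]) (simp add: ell2_eqI)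

lemma ops_id [simp]: "id_blinfun \<in> ops"
  by (rule opsI[OF _ adjoint_pair_id]) simp

lemma ops_add [simp]: "\<lbrakk>T \<in> ops; S \<in> ops\<rbrakk> \<Longrightarrow> T + S \<in> ops"
  by (rule opsI[OF _ adjoint_pair_add[OF adjoint_pair_star adjoint_pair_star]])
    (simp_all add: blinfun.add_left ops_imult)

lemma ops_compose [simp]: "\<lbrakk>T \<in> ops; S \<in> ops\<rbrakk> \<Longrightarrow> T o\<^sub>L S \<in> ops"
  by (rule opsI[OF _ adjoint_pair_compose[OF adjoint_pair_star adjoint_pair_star]])
    (simp_all add: ops_imult)

lemma ops_cscale [simp]: "T \<in> ops \<Longrightarrow> cscale c T \<in> ops"
  by (rule opsI[OF _ adjoint_pair_cscale]) (simp_all add: cscale_apply ops_imult)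

lemma cscale_minus_one: "cscale (-1) T = - T"
  by (rule blinfun_eqI) (simp add: cscale_apply blinfun.minus_left)

lemma ops_uminus [simp]: "T \<in> ops \<Longrightarrow> - T \<in> ops"
  using ops_cscale[of T "-1"] by (simp add: cscale_minus_one)

lemma ops_minus [simp]: "\<lbrakk>T \<in> ops; S \<in> ops\<rbrakk> \<Longrightarrow> T - S \<in> ops"
  using ops_add[of T "- S"] by simp

lemma ops_sum: "(\<And>k. k \<in> F \<Longrightarrow> T k \<in> ops) \<Longrightarrow> (\<Sum>k\<in>F. T k) \<in> ops"
  by (induction F rule: infinite_finite_induct) auto

lemma star_add: "\<lbrakk>T \<in> ops; S \<in> ops\<rbrakk> \<Longrightarrow> star (T + S) = star T + star S"
  by (intro star_eqI adjoint_pair_add adjoint_pair_star)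

lemma star_compose: "\<lbrakk>T \<in> ops; S \<in> ops\<rbrakk> \<Longrightarrow> star (T o\<^sub>L S) = star S o\<^sub>L star T"
  by (intro star_eqI adjoint_pair_compose adjoint_pair_star)

lemma star_cscale: "T \<in> ops \<Longrightarrow> star (cscale c T) = cscale (cnj c) (star T)"
  by (intro star_eqI adjoint_pair_cscale)

lemma star_minus: "\<lbrakk>T \<in> ops; S \<in> ops\<rbrakk> \<Longrightarrow> star (T - S) = star T - star S"
  using star_add[of T "- S"] star_cscale[of S "-1"] by (simp add: cscale_minus_one)

lemma norm_star_le:
  assumes T: "T \<in> ops"
  shows "norm (star T) \<le> norm T"
proof (rule norm_blinfun_bound)
  fix y
  have "norm (star T y) * norm (star T y) \<le> (norm T * norm y) * norm (star T y)"
  proof -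
    have "norm (star T y) * norm (star T y) = star T y \<bullet> star T y"
      by (simp add: power2_norm_eq_inner flip: power2_eq_square)
    also have "\<dots> = T (star T y) \<bullet> y" using T by (simp add: star_inner)
    also have "\<dots> \<le> norm (T (star T y)) * norm y" by (rule norm_cauchy_schwarz)
    also have "\<dots> \<le> (norm T * norm (star T y)) * norm y" by (intro mult_right_mono norm_blinfun) auto
    finally show ?thesis by (simp add: ac_simps)
  qed
  then show "norm (star T y) \<le> norm T * norm y"
    by (cases "star T y = 0") auto
qed simp

text \<open>The lower bound comes from rewriting the squared norm of \<open>T x\<close> as the inner
  product of \<open>x\<close> with \<open>star T\<close> applied to \<open>T x\<close>, followed by
  Cauchy-Schwarz.\<close>

lemma norm_star_compose:
  assumes T: "T \<in> ops"
  shows "norm (star T o\<^sub>L T) = (norm T)\<^sup>2"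
proof (rule antisym)
  have "norm (star T o\<^sub>L T) \<le> norm (star T) * norm T" by (rule norm_blinfun_compose)
  also have "\<dots> \<le> norm T * norm T" using norm_star_le[OF T] by (intro mult_right_mono) auto
  finally show "norm (star T o\<^sub>L T) \<le> (norm T)\<^sup>2" by (simp add: power2_eq_square)
  have "norm T \<le> sqrt (norm (star T o\<^sub>L T))"
  proof (rule norm_blinfun_bound)
    fix x
    have "(norm (T x))\<^sup>2 = x \<bullet> (star T o\<^sub>L T) x" using T by (simp add: power2_norm_eq_inner star_inner)
    also have "\<dots> \<le> norm x * norm ((star T o\<^sub>L T) x)" by (rule norm_cauchy_schwarz)
    also have "\<dots> \<le> norm x * (norm (star T o\<^sub>L T) * norm x)" by (intro mult_left_mono norm_blinfun) auto
    also have "\<dots> = (sqrt (norm (star T o\<^sub>L T)) * norm x)\<^sup>2"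
      by (simp add: power_mult_distrib) (simp add: power2_eq_square)
    finally show "norm (T x) \<le> sqrt (norm (star T o\<^sub>L T)) * norm x" by (rule power2_le_imp_le) simp
  qed simp
  then have "(norm T)\<^sup>2 \<le> (sqrt (norm (star T o\<^sub>L T)))\<^sup>2" by (intro power_mono) auto
  then show "(norm T)\<^sup>2 \<le> norm (star T o\<^sub>L T)" by simp
qed

lemma norm_cscale: "norm (cscale c T) = cmod c * norm T"
proof -
  have n: "norm (cscale c T x) = cmod c * norm (T x)" for c and T :: "'i ell2_map" and x
  proof -
    have "(norm (cscale c T x))\<^sup>2 = (cmod c * norm (T x))\<^sup>2"
      by (simp add: norm_ell2_sq power_mult_distrib norm_mult infsum_cmult_right')
    then show ?thesis by (subst (asm) power2_eq_iff_nonneg) auto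
  qed
  have le: "norm (cscale c T) \<le> cmod c * norm T" for c and T :: "'i ell2_map"
    by (rule norm_blinfun_bound) (auto simp: n mult.assoc intro!: mult_left_mono norm_blinfun)
  show ?thesis
  proof (cases "c = 0")
    case False
    have "cscale (inverse c) (cscale c T) = T"
      by (intro blinfun_eqI ell2_eqI) (simp add: False)
    then have "norm T \<le> inverse (cmod c) * norm (cscale c T)"
      using le[of "inverse c" "cscale c T"] by (simp add: norm_inverse)
    then have "cmod c * norm T \<le> norm (cscale c T)" using False by (simp add: field_simps)
    then show ?thesis using le[of c T] by simp
  next
    case True
    then show ?thesis using le[of c T] by simp
  qed
qed

text \<open>\<open>star\<close> does not increase norms, so the adjoints form a Cauchy sequence too,
  and their limit is an adjoint of the limit.\<close>

lemma ops_complete: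
  assumes f: "\<And>n :: nat. f n \<in> ops" and "Cauchy f"
  shows "\<exists>T\<in>ops. f \<longlonglongrightarrow> T"
proof -
  obtain T where T: "f \<longlonglongrightarrow> T" using \<open>Cauchy f\<close> by (auto simp: Cauchy_convergent_iff convergent_def)
  have "Cauchy (\<lambda>n. star (f n))"
  proof (rule metric_CauchyI)
    fix e :: real assume "e > 0"
    then obtain N where N: "\<And>m n. m \<ge> N \<Longrightarrow> n \<ge> N \<Longrightarrow> dist (f m) (f n) < e"
      using \<open>Cauchy f\<close> by (meson metric_CauchyD)
    have "dist (star (f m)) (star (f n)) \<le> dist (f m) (f n)" for m n
      using norm_star_le[of "f m - f n"] f by (simp add: dist_norm star_minus)
    then show "\<exists>N. \<forall>m\<ge>N. \<forall>n\<ge>N. dist (star (f m)) (star (f n)) < e"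
      using N by (meson le_less_trans)
  qed
  then obtain S where S: "(\<lambda>n. star (f n)) \<longlonglongrightarrow> S" by (auto simp: Cauchy_convergent_iff convergent_def)
  have lim: "(\<lambda>n. f n x) \<longlonglongrightarrow> T x" for x by (rule blinfun.tendsto[OF T tendsto_const])
  have limS: "(\<lambda>n. star (f n) x) \<longlonglongrightarrow> S x" for x by (rule blinfun.tendsto[OF S tendsto_const])
  have "T \<in> ops"
  proof (rule opsI)
    fix x
    have "(\<lambda>n. imult (f n x)) \<longlonglongrightarrow> imult (T x)"
      using lim by (rule bounded_linear.tendsto[OF bounded_linear_imult])
    moreover have "(\<lambda>n. imult (f n x)) \<longlonglongrightarrow> T (imult x)"
      using lim[of "imult x"] f by (simp add: ops_imult)
    ultimately show "T (imult x) = imult (T x)" by (rule LIMSEQ_unique[symmetric])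
  next
    show "adjoint_pair T S"
      unfolding adjoint_pair_def
    proof (intro allI)
      fix x y
      have "(\<lambda>n. f n x \<bullet> y) \<longlonglongrightarrow> T x \<bullet> y" by (rule tendsto_inner[OF lim tendsto_const])
      moreover have "(\<lambda>n. f n x \<bullet> y) \<longlonglongrightarrow> x \<bullet> S y"
        using f by (simp add: star_inner tendsto_inner[OF tendsto_const limS])
      ultimately show "T x \<bullet> y = x \<bullet> S y" by (rule LIMSEQ_unique)
    qed
  qed
  then show ?thesis using T by blast
qed

text \<open>The universal property only speaks of algebras of functions \<open>nat \<Rightarrow> complex\<close>, so operators are
  replaced by their matrices.\<close>

definition encode :: "'i::countable ell2_map \<Rightarrow> nat \<Rightarrow> complex" where
  "encode T n = (case from_nat n of (i, j) \<Rightarrow> coord (blinfun_apply T (ell2_unit i)) j)"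

text \<open>The values on the basis vectors determine every coordinate of the adjoint through
  \<open>coord_eq_inner\<close>. Hence the adjoints agree, and so do the operators, without a
  density argument for the basis.\<close>

lemma inj_on_encode: "inj_on encode (ops :: 'i::countable ell2_map set)"
proof (rule inj_onI)
  fix T S :: "'i ell2_map" assume T: "T \<in> ops" and S: "S \<in> ops" and eq: "encode T = encode S"
  have "coord (T (ell2_unit i)) j = coord (S (ell2_unit i)) j" for i j
    using fun_cong[OF eq, of "to_nat (i, j)"] by (simp add: encode_def)
  then have e: "T (ell2_unit i) = S (ell2_unit i)" for i by (rule ell2_eqI)
  have c: "coord (star R y) i = Complex (y \<bullet> R (ell2_unit i)) (y \<bullet> imult (R (ell2_unit i)))"
    if R: "R \<in> ops" for R :: "'i ell2_map" and y i
    using star_inner[OF R, of "ell2_unit i" y] star_inner[OF R, of "imult (ell2_unit i)" y]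
    by (simp add: coord_eq_inner ops_imult[OF R] inner_commute)
  have "star T = star S"
    by (intro blinfun_eqI ell2_eqI) (simp add: c T S e)
  then show "T = S" using T S star_star by metis
qed

definition decode :: "(nat \<Rightarrow> complex) \<Rightarrow> 'i::countable ell2_map" where
  "decode = inv_into ops encode"

lemma decode_encode [simp]: "T \<in> ops \<Longrightarrow> decode (encode T) = T"
  by (simp add: decode_def inj_on_encode)

text \<open>The resulting type does not mention \<open>'i\<close>, so the index type is passed as an
  \<open>itself\<close> argument.\<close>

definition op_algebra :: "'i::countable itself \<Rightarrow> (nat \<Rightarrow> complex) cstar" where
  "op_algebra _ =
    \<lparr>carrier = encode ` (ops :: 'i ell2_map set),
     monoid.mult = \<lambda>x y. encode (decode x o\<^sub>L decode y :: 'i ell2_map),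
     one = encode (id_blinfun :: 'i ell2_map),
     zero = encode (0 :: 'i ell2_map),
     add = \<lambda>x y. encode (decode x + decode y :: 'i ell2_map),
     module.smult = \<lambda>c x. encode (cscale c (decode x) :: 'i ell2_map),
     adj = \<lambda>x. encode (star (decode x) :: 'i ell2_map),
     nrm = \<lambda>x. norm (decode x :: 'i ell2_map)\<rparr>"

section \<open>The coded operators form a unital C*-algebra\<close>

context
  fixes M :: "(nat \<Rightarrow> complex) cstar"
  defines "M \<equiv> op_algebra TYPE('i::countable)"
begin

private abbreviation cd :: "'i ell2_map \<Rightarrow> nat \<Rightarrow> complex" where "cd \<equiv> encode"

lemma op_algebra_simps:
  "carrier M = cd ` ops" "\<zero>\<^bsub>M\<^esub> = cd 0" "\<one>\<^bsub>M\<^esub> = cd id_blinfun"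
  "\<lbrakk>T \<in> ops; S \<in> ops\<rbrakk> \<Longrightarrow> cd T \<oplus>\<^bsub>M\<^esub> cd S = cd (T + S)"
  "\<lbrakk>T \<in> ops; S \<in> ops\<rbrakk> \<Longrightarrow> cd T \<otimes>\<^bsub>M\<^esub> cd S = cd (T o\<^sub>L S)"
  "T \<in> ops \<Longrightarrow> c \<odot>\<^bsub>M\<^esub> cd T = cd (cscale c T)"
  "T \<in> ops \<Longrightarrow> adj M (cd T) = cd (star T)"
  "T \<in> ops \<Longrightarrow> nrm M (cd T) = norm T"
  by (simp_all add: M_def op_algebra_def)

lemma abelian_group_op_algebra: "abelian_group M"
proof (rule abelian_groupI)
  fix x assume "x \<in> carrier M"
  then obtain T where T: "T \<in> ops" "x = cd T" by (auto simp: op_algebra_simps)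
  then have "cd (- T) \<oplus>\<^bsub>M\<^esub> x = \<zero>\<^bsub>M\<^esub>" "cd (- T) \<in> carrier M" by (simp_all add: op_algebra_simps)
  then show "\<exists>y\<in>carrier M. y \<oplus>\<^bsub>M\<^esub> x = \<zero>\<^bsub>M\<^esub>" by blast
qed (auto simp: op_algebra_simps algebra_simps)

lemma op_algebra_minus:
  assumes "T \<in> ops" "S \<in> ops"
  shows "cd T \<ominus>\<^bsub>M\<^esub> cd S = cd (T - S)"
proof -
  interpret abelian_group M by (rule abelian_group_op_algebra)
  have "\<ominus>\<^bsub>M\<^esub> cd S = cd (- S)"
    by (rule minus_equality) (use assms in \<open>simp_all add: op_algebra_simps\<close>)
  then show ?thesis using assms by (simp add: a_minus_def op_algebra_simps)
qed

lemma op_algebra_finsum: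
  assumes "finite F" "\<And>k. k \<in> F \<Longrightarrow> T k \<in> ops"
  shows "(\<Oplus>\<^bsub>M\<^esub>k\<in>F. cd (T k)) = cd (\<Sum>k\<in>F. T k)"
proof -
  interpret abelian_group M by (rule abelian_group_op_algebra)
  show ?thesis using assms
  proof (induction F rule: finite_induct)
    case (insert k F)
    then have "(\<Sum>k\<in>F. T k) \<in> ops" by (intro ops_sum) auto
    moreover have "(\<lambda>k. cd (T k)) \<in> F \<rightarrow> carrier M" "cd (T k) \<in> carrier M"
      using insert by (auto simp: op_algebra_simps)
    ultimately show ?case using insert by (simp add: finsum_insert op_algebra_simps)
  qed (simp add: op_algebra_simps)
qed

lemma cscale_algebra:
  fixes T S :: "'i ell2_map"
  shows "cscale (c + d) T = cscale c T + cscale d T" "cscale c (T + S) = cscale c T + cscale c S"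
    "cscale (c * d) T = cscale c (cscale d T)" "cscale 1 T = T"
    "cscale c T o\<^sub>L S = cscale c (T o\<^sub>L S)"
    "T \<in> ops \<Longrightarrow> T o\<^sub>L cscale c S = cscale c (T o\<^sub>L S)"
proof -
  assume T: "T \<in> ops"
  show "T o\<^sub>L cscale c S = cscale c (T o\<^sub>L S)"
    by (rule blinfun_eqI)
      (simp add: cscale_apply blinfun.add_right blinfun.scaleR_right ops_imult[OF T])
qed (auto intro!: blinfun_eqI ell2_eqI simp: blinfun.add_left algebra_simps)

lemma unital_cstar_algebra_op_algebra: "unital_cstar_algebra M"
proof -
  interpret abelian_group M by (rule abelian_group_op_algebra)
  have m: "carrier M = cd ` ops" by (rule op_algebra_simps)
  note s = op_algebra_simps(2-)
  show ?thesis
  proof (unfold_locales, goal_cases)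
    \<comment> \<open>Goal 23 is completeness: after decoding, the hypothesis says that the
      operators are Cauchy in operator norm.\<close>
    case (23 f)
    have "\<forall>n. \<exists>T\<in>ops. f n = cd T" using 23(1) unfolding m by blast
    then obtain T where T: "\<And>n. T n \<in> ops" "\<And>n. f n = cd (T n)" by metis
    have d: "nrm M (f i \<ominus>\<^bsub>M\<^esub> f j) = dist (T i) (T j)" for i j
      using T by (simp add: op_algebra_minus s dist_norm)
    have "Cauchy T"
      unfolding Cauchy_def using 23(2) by (simp add: d)
    then obtain L where L: "L \<in> ops" "T \<longlonglongrightarrow> L" using ops_complete[of T] T by blast
    have "(\<lambda>n. nrm M (f n \<ominus>\<^bsub>M\<^esub> cd L)) \<longlonglongrightarrow> 0"
      using L T by (simp add: op_algebra_minus s) (simp add: tendsto_norm_zero_iff LIM_zero_iff)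
    then show ?case using L by (auto simp: m)
  qed (auto simp: m s cscale_algebra star_add star_compose star_cscale
      norm_triangle_ineq norm_cscale norm_blinfun_compose norm_star_compose inj_on_eq_iff[OF inj_on_encode]
      blinfun_eqI blinfun.add_left blinfun.add_right)
qed

end

section \<open>The monotone Fock representation\<close>

text \<open>For \<open>h\<close> injective on \<open>D\<close> this is the partial isometry whose
  matrix is a partial permutation. It pulls coordinates back along \<open>h\<close>, so it sends the
  basis vector at \<open>h i\<close> to the one at \<open>i\<close>.\<close>

definition part_op :: "'i set \<Rightarrow> ('i \<Rightarrow> 'i) \<Rightarrow> 'i ell2_map" where
  "part_op D h = Blinfun (\<lambda>x. Abs_ell2 (\<lambda>i. if i \<in> D then coord x (h i) else 0))"

text \<open>Injectivity makes every finite partial sum for the image a partial sum for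
  \<open>x\<close>. This justifies both uses of the abstraction functions, for square-summability
  and for boundedness.\<close>

lemma coord_part_op:
  assumes h: "inj_on h D"
  shows "coord (blinfun_apply (part_op D h) x) i = (if i \<in> D then coord x (h i) else 0)"
proof -
  define g where "g x i = (if i \<in> D then coord x (h i) else 0)" for x i
  have bound: "(\<Sum>i\<in>F. (cmod (g x i))\<^sup>2) \<le> (norm x)\<^sup>2" if "finite F" for F x
  proof -
    have "(\<Sum>i\<in>F. (cmod (g x i))\<^sup>2) = (\<Sum>i\<in>F \<inter> D. (cmod (coord x (h i)))\<^sup>2)"
      using that by (intro sum.mono_neutral_cong_right) (auto simp: g_def)
    also have "\<dots> = (\<Sum>j\<in>h ` (F \<inter> D). (cmod (coord x j))\<^sup>2)"
      using inj_on_subset[OF h] by (simp add: sum.reindex)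
    also have "\<dots> \<le> (norm x)\<^sup>2" using that by (intro sum_coord_le_norm) auto
    finally show ?thesis .
  qed
  have "sq_summable (g x)" for x
    using bound by (rule sq_summableI)
  then have c: "coord (Abs_ell2 (g x)) = g x" for x by (simp add: Abs_ell2_inverse)
  have "bounded_linear (\<lambda>x. Abs_ell2 (g x))"
  proof (rule bounded_linear_intro[where K = 1])
    show "Abs_ell2 (g (x + y)) = Abs_ell2 (g x) + Abs_ell2 (g y)" for x y
      by (rule ell2_eqI) (simp add: c, simp add: g_def)
    show "Abs_ell2 (g (r *\<^sub>R x)) = r *\<^sub>R Abs_ell2 (g x)" for r x
      by (rule ell2_eqI) (simp add: c, simp add: g_def)
    show "norm (Abs_ell2 (g x)) \<le> norm x * 1" for x
      by (rule norm_ell2_leI) (simp_all add: c bound)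
  qed
  then have "part_op D h x = Abs_ell2 (g x)"
    by (simp add: part_op_def bounded_linear_Blinfun_apply flip: g_def)
  then show ?thesis by (simp add: c) (simp add: g_def)
qed

lemma adjoint_pair_part_op:
  assumes D': "D' = h ` D" and inv: "\<And>i. i \<in> D \<Longrightarrow> h' (h i) = i"
  shows "adjoint_pair (part_op D h) (part_op D' h')"
  unfolding adjoint_pair_def
proof (intro allI)
  fix x y
  have h: "inj_on h D" using inv by (rule inj_on_inverseI)
  have h': "inj_on h' D'" using inv by (auto simp: D' inj_on_def)
  have "part_op D h x \<bullet> y = (\<Sum>\<^sub>\<infinity>i\<in>D. coord x (h i) \<bullet> coord y i)"
    unfolding inner_ell2_def by (rule infsum_cong_neutral) (auto simp: coord_part_op[OF h])
  also have "\<dots> = (\<Sum>\<^sub>\<infinity>i\<in>D. ((\<lambda>j. coord x j \<bullet> coord y (h' j)) \<circ> h) i)"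
    by (rule infsum_cong) (simp add: inv)
  also have "\<dots> = (\<Sum>\<^sub>\<infinity>j\<in>D'. coord x j \<bullet> coord y (h' j))"
    unfolding D' by (rule infsum_reindex[OF h, symmetric])
  also have "\<dots> = x \<bullet> part_op D' h' y"
    unfolding inner_ell2_def by (rule infsum_cong_neutral) (auto simp: coord_part_op[OF h'])
  finally show "part_op D h x \<bullet> y = x \<bullet> part_op D' h' y" .
qed

lemma part_op_imult: "inj_on h D \<Longrightarrow> part_op D h (imult x) = imult (part_op D h x)"
  by (rule ell2_eqI) (simp add: coord_part_op)

text \<open>The basis is indexed by all integer lists, the empty one being the vacuum. The operator
  is zero on lists that are not strictly increasing, so the monotone Fock space is a direct summand
  and the rest contributes nothing.\<close>

definition annihilator :: "int \<Rightarrow> int list ell2_map" where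
  "annihilator i = part_op {l. sorted_wrt (<) (i # l)} ((#) i)"

definition creator :: "int \<Rightarrow> int list ell2_map" where
  "creator i = part_op {m. m \<noteq> [] \<and> hd m = i \<and> sorted_wrt (<) m} tl"

lemma adjoint_pair_annihilator: "adjoint_pair (annihilator i) (creator i)"
  unfolding annihilator_def creator_def
proof (rule adjoint_pair_part_op)
  show "{m. m \<noteq> [] \<and> hd m = i \<and> sorted_wrt (<) m} = (#) i ` {l. sorted_wrt (<) (i # l)}"
  proof (intro equalityI subsetI)
    fix m assume "m \<in> {m. m \<noteq> [] \<and> hd m = i \<and> sorted_wrt (<) m}"
    then show "m \<in> (#) i ` {l. sorted_wrt (<) (i # l)}" by (cases m) auto
  qed auto
qed simp

lemma annihilator_ops [simp]: "annihilator i \<in> ops"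
  by (rule opsI[OF _ adjoint_pair_annihilator]) (simp add: annihilator_def part_op_imult)

lemma star_annihilator [simp]: "star (annihilator i) = creator i"
  by (rule star_eqI[OF adjoint_pair_annihilator])

lemma creator_ops [simp]: "creator i \<in> ops"
  using star_ops[OF annihilator_ops, of i] by simp

lemma coord_annihilator:
  "coord (blinfun_apply (annihilator i) x) l = (if sorted_wrt (<) (i # l) then coord x (i # l) else 0)"
  by (simp add: annihilator_def coord_part_op)

lemma coord_creator:
  "coord (blinfun_apply (creator i) x) l =
    (case l of [] \<Rightarrow> 0 | k # l' \<Rightarrow> if k = i \<and> sorted_wrt (<) (i # l') then coord x l' else 0)"
proof -
  have "inj_on tl {m. m \<noteq> [] \<and> hd m = i \<and> sorted_wrt (<) m}"
    by (auto simp: inj_on_def neq_Nil_conv)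
  then show ?thesis by (auto simp: creator_def coord_part_op split: list.split)
qed

lemma annihilator_nonzero: "annihilator i \<noteq> 0"
proof
  assume "annihilator i = 0"
  then have "coord (annihilator i (ell2_unit [i])) [] = 0" by simp
  then show False by (simp add: coord_annihilator)
qed

lemma sorted_wrt_less_Cons:
  "sorted_wrt (<) (i # l) \<longleftrightarrow> sorted_wrt (<) l \<and> (case l of [] \<Rightarrow> True | k # _ \<Rightarrow> i < k)"
  for i :: int
  by (cases l) auto

abbreviation fock_algebra :: "(nat \<Rightarrow> complex) cstar" where
  "fock_algebra \<equiv> op_algebra TYPE(int list)"

lemmas fock_simps = op_algebra_simps[where 'i = "int list"]
  op_algebra_minus[where 'i = "int list"] op_algebra_finsum[where 'i = "int list"]

lemma monotone_rules_fock: "monotone_rules fock_algebra (\<lambda>i. encode (annihilator i))"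
proof -
  have 1: "annihilator i o\<^sub>L annihilator j = 0" if "i \<le> j" for i j
    using that by (intro blinfun_eqI ell2_eqI) (simp add: coord_annihilator)
  have 2: "annihilator i o\<^sub>L annihilator j o\<^sub>L creator j = cscale (mono_alpha i j) (annihilator i)" for i j
    by (intro blinfun_eqI ell2_eqI)
      (auto simp: coord_annihilator coord_creator mono_alpha_def)
  \<comment> \<open>Over the integers, \<open>i - 1 < k\<close> without \<open>i < k\<close> means
    \<open>k = i\<close>, so the difference of the two projections singles out the increasing lists
    that start with \<open>i\<close>.\<close>
  have 3: "creator i o\<^sub>L annihilator i =
      (annihilator (i - 1) o\<^sub>L creator (i - 1)) - (annihilator i o\<^sub>L creator i)" for i
    by (intro blinfun_eqI ell2_eqI)
      (auto simp: coord_annihilator coord_creator sorted_wrt_less_Cons blinfun.diff_left split: list.splits)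
  have 4: "annihilator i o\<^sub>L creator i o\<^sub>L annihilator j = annihilator j -
      cscale (mono_alpha i j) (\<Sum>k\<in>{j<..i}. creator k o\<^sub>L annihilator k o\<^sub>L annihilator j)" for i j
  proof (intro blinfun_eqI ell2_eqI)
    fix x :: "int list ell2" and l
    \<comment> \<open>At the list \<open>l\<close> only the term whose \<open>k\<close> is the head
      of \<open>l\<close> can survive, and the empty list receives nothing.\<close>
    have sum: "(\<Sum>k\<in>{j<..i}. coord (creator k (annihilator k (annihilator j x))) l) =
        (case l of [] \<Rightarrow> 0 | m # _ \<Rightarrow>
          if m \<in> {j<..i} \<and> sorted_wrt (<) (j # l) then coord x (j # l) else 0)"
    proof (cases l)
      case Nil
      then show ?thesis by (simp add: coord_creator)
    next
      case (Cons m l')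
      then have "(\<Sum>k\<in>{j<..i}. coord (creator k (annihilator k (annihilator j x))) l) =
          (\<Sum>k\<in>{j<..i}. if m = k then (if sorted_wrt (<) (j # l) then coord x (j # l) else 0) else 0)"
        by (intro sum.cong) (auto simp: coord_annihilator coord_creator)
      then show ?thesis using Cons by simp
    qed
    show "coord ((annihilator i o\<^sub>L creator i o\<^sub>L annihilator j) x) l = coord ((annihilator j -
        cscale (mono_alpha i j) (\<Sum>k\<in>{j<..i}. creator k o\<^sub>L annihilator k o\<^sub>L annihilator j)) x) l"
    proof -
      have "coord ((annihilator j -
          cscale (mono_alpha i j) (\<Sum>k\<in>{j<..i}. creator k o\<^sub>L annihilator k o\<^sub>L annihilator j)) x) l =
        coord (annihilator j x) l - mono_alpha i j * (case l of [] \<Rightarrow> 0 | m # _ \<Rightarrow>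
          if m \<in> {j<..i} \<and> sorted_wrt (<) (j # l) then coord x (j # l) else 0)"
        by (simp add: blinfun.diff_left blinfun.sum_left sum)
      then show ?thesis
        by (cases l) (auto simp: mono_alpha_def coord_annihilator coord_creator)
    qed
  qed
  show ?thesis
    unfolding monotone_rules_def
    by (simp add: fock_simps ops_sum 1 2 3[symmetric] 4)
qed

theorem corollary3p6:
  fixes B :: "'a cstar" and b :: "int \<Rightarrow> 'a"
  assumes "universal_monotone_algebra B b"
  shows "simple_cstar_algebra (B\<lparr>carrier := cstar_generated B (range b)\<rparr>)"
proof -
  interpret monotone_family B b
    using assms unfolding universal_monotone_algebra_def monotone_family_def monotone_family_axioms_def
    by blast
  \<comment> \<open>The coded Fock operators have the carrier type on which universality is tested,
    and they satisfy the rules.\<close>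
  have "\<exists>h \<in> unital_star_hom B fock_algebra. \<forall>i. h (b i) = encode (annihilator i)"
  proof -
    have "unital_cstar_algebra fock_algebra \<and> range (\<lambda>i. encode (annihilator i)) \<subseteq> carrier fock_algebra \<and>
        monotone_rules fock_algebra (\<lambda>i. encode (annihilator i))"
      using monotone_rules_fock unital_cstar_algebra_op_algebra[where 'i = "int list"]
      by (auto simp: fock_simps)
    then show ?thesis using assms unfolding universal_monotone_algebra_def by blast
  qed
  then obtain h where h: "h \<in> unital_star_hom B fock_algebra" "h (b 0) = encode (annihilator 0)" by blast
  have "b 0 \<noteq> \<zero>\<^bsub>B\<^esub>"
  proof
    assume "b 0 = \<zero>\<^bsub>B\<^esub>"
    \<comment> \<open>Membership in \<open>ring_hom\<close> speaks of products, sums and the unit;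
      that a zero \<open>b 0\<close> has a zero image is read off from compatibility with the scalar
      0.\<close>
    then have "0 \<odot>\<^bsub>B\<^esub> b 0 = b 0" by simp
    then have "h (b 0) = 0 \<odot>\<^bsub>fock_algebra\<^esub> h (b 0)"
      using h(1) unfolding unital_star_hom_def by (smt (verit) mem_Collect_eq b_closed)
    then have "encode (annihilator 0) = encode (cscale 0 (annihilator 0))"
      by (simp add: h(2) fock_simps)
    then have "annihilator 0 = cscale 0 (annihilator 0)"
      using inj_onD[OF inj_on_encode] by (metis annihilator_ops ops_cscale)
    also have "\<dots> = 0" by (simp add: cscale_def)
    finally show False using annihilator_nonzero by blast
  qed
  then show ?thesis using simple_gen by (simp add: gen_def)
qed

end
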